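(* Let $F:\mathcal{A}\to\mathcal{C}$ be a faithful $\mathcal{M}$-fibration and let $\mathcal{S}$ be a syntopogenous structure on $\mathcal{C}$ with respect to $\mathcal{M}$. For $X\in\mathcal{A}$ put $$\mathcal{S}^F_X=\{\sqsubset^F_X\;|\;\sqsubset_{FX}\in\mathcal{S}_{FX}\},\qquad m\sqsubset^F_X n\iff Fm\sqsubset_{FX}\gamma_X(n)\quad(m,n\in\mathrm{sub}X).$$ Then $\mathcal{S}^F$ is a syntopogenous structure on $\mathcal{A}$ with respect to $\mathcal{M}_F$, which is interpolative, respectively co-perfect, provided $\mathcal{S}$ has the same property. Moreover, an $\mathcal{A}$-morphism $f$ is $\mathcal{S}^F$-initial provided $Ff$ is $\mathcal{S}$-initial.
   Context: $\mathcal{C}$ is a category with a proper $(\mathcal{E},\mathcal{M})$-factorization system for morphisms ($\mathcal{E}$ consists of epimorphisms, $\mathcal{M}$ of monomorphisms), and it is $\mathcal{M}$-complete: pullbacks of $\mathcal{M}$-morphisms along arbitrary morphisms and arbitrary $\mathcal{M}$-intersections exist and are again in $\mathcal{M}$. For $X\in\mathcal{C}$, $\mathrm{sub}X=\{m\in\mathcal{M}\mid \mathrm{cod}(m)=X\}$, ordered by $n\le m$ iff $m\circ j=n$ for some $j$; isomorphic subobjects are identified, so $\mathrm{sub}X$ is a (possibly large) complete lattice. For $f:X\to Y$, $f(m)$ is the $\mathcal{M}$-component of the factorization of $f\circ m$ and $f^{-1}(n)$ is the pullback of $n$ along $f$. A morphism $f:X\to Y$ of $\mathcal{A}$ is $F$-initial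 ($F$-cartesian) if for every $h:Z\to Y$ in $\mathcal{A}$ and $u:FZ\to FX$ with $Ff\circ u=Fh$ there is a unique $v:Z\to X$ with $Fv=u$ and $f\circ v=h$; $\mathrm{Ini}F$ is the class of these. A faithful functor $F:\mathcal{A}\to\mathcal{C}$ is an $\mathcal{M}$-fibration if every $g:A\to FY$ with $g\in\mathcal{M}$ has an $F$-initial lifting. Then $\mathcal{A}$ carries the factorization system $(\mathcal{E}_F,\mathcal{M}_F)$, $\mathcal{E}_F=F^{-1}\mathcal{E}$, $\mathcal{M}_F=F^{-1}\mathcal{M}\cap\mathrm{Ini}F$, and is $\mathcal{M}_F$-complete; for $X\in\mathcal{A}$, $\mathrm{sub}X$ and images/inverse images are formed with respect to $\mathcal{M}_F$. The maps $\gamma_X:\mathrm{sub}X\to\mathrm{sub}FX$, $\gamma_X(m)=Fm$, and $\delta_X:\mathrm{sub}FX\to\mathrm{sub}X$, $\delta_X(n)=p$ with $Fp=n$ and $p\in\mathrm{Ini}F$, are mutually inverse order equivalences, and $F$ preserves images and inverse images of subobjects. The following notions are for $\mathcal{C}$ with $\mathcal{M}$ and likewise for $\mathcal{A}$ with $\mathcal{M}_F$. A topogenous order is a family of relations $\sqsubset_X$ on $\mathrm{sub}X$ with (T1) $m\sqsubset_X n\Rightarrow m\le n$; (T2) $m\le n\sqsubset_X p\le q\Rightarrow m\sqsubset_X q$; (T3) for every $f:X\to Y$, $m\sqsubset_Y n\Rightarrow f^{-1}(m)\sqsubset_X f^{-1}(n)$. A relation is $\bigwedge$-preserving if ($m\sqsubset_X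 n_i$ for all $i\in I$) implies $m\sqsubset_X\bigwedge n_i$, and interpolates if $m\sqsubset_X n$ implies $m\sqsubset_X p\sqsubset_X n$ for some $p$. A syntopogenous structure is a family $\mathcal{S}=\{\mathcal{S}_X\}$ of sets of relations on $\mathrm{sub}X$ such that (S1) each $\sqsubset_X\in\mathcal{S}_X$ satisfies (T1), (T2); (S2) $\mathcal{S}_X$ is directed under inclusion; (S3) the relations $\bigcup\mathcal{S}_X$ form an interpolative topogenous order. It is co-perfect (interpolative) if every $\sqsubset_X\in\mathcal{S}_X$ is $\bigwedge$-preserving (interpolates). A morphism $f:X\to Y$ is $\mathcal{S}$-initial if for every $\sqsubset_X\in\mathcal{S}_X$ there is $\sqsubset_Y\in\mathcal{S}_Y$ such that $m\sqsubset_X n$ implies $f(m)\sqsubset_Y p$ and $f^{-1}(p)\le n$ for some $p\in\mathrm{sub}Y$. *)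

theory Defs
  imports "HOL-Algebra.Complete_Lattice"
begin

section \<open>Categories\<close>

record ('o, 'a) cat =
  Obj :: "'o set"
  Arr :: "'a set"
  Dom :: "'a \<Rightarrow> 'o"
  Cod :: "'a \<Rightarrow> 'o"
  Id :: "'o \<Rightarrow> 'a"
  Comp :: "'a \<Rightarrow> 'a \<Rightarrow> 'a"  (infixr "\<cdot>\<index>" 75)

definition Hom :: "('o, 'a, 'x) cat_scheme \<Rightarrow> 'o \<Rightarrow> 'o \<Rightarrow> 'a set" where
  "Hom C X Y = {f \<in> Arr C. Dom C f = X \<and> Cod C f = Y}"

locale category =
  fixes C (structure)
  assumes Dom_Obj: "f \<in> Arr C \<Longrightarrow> Dom C f \<in> Obj C"
    and Cod_Obj: "f \<in> Arr C \<Longrightarrow> Cod C f \<in> Obj C"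
    and Id_Hom: "X \<in> Obj C \<Longrightarrow> Id C X \<in> Hom C X X"
    and Comp_Hom: "\<lbrakk>f \<in> Hom C X Y; g \<in> Hom C Y Z\<rbrakk> \<Longrightarrow> g \<cdot> f \<in> Hom C X Z"
    and Comp_Id: "f \<in> Hom C X Y \<Longrightarrow> f \<cdot> Id C X = f"
    and Id_Comp: "f \<in> Hom C X Y \<Longrightarrow> Id C Y \<cdot> f = f"
    and Comp_assoc:
      "\<lbrakk>f \<in> Hom C W X; g \<in> Hom C X Y; h \<in> Hom C Y Z\<rbrakk> \<Longrightarrow> (h \<cdot> g) \<cdot> f = h \<cdot> (g \<cdot> f)"

definition is_epi :: "('o, 'a, 'x) cat_scheme \<Rightarrow> 'a \<Rightarrow> bool" where
  "is_epi C f \<longleftrightarrow> f \<in> Arr C \<and>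
     (\<forall>Z. \<forall>g \<in> Hom C (Cod C f) Z. \<forall>h \<in> Hom C (Cod C f) Z. g \<cdot>\<^bsub>C\<^esub> f = h \<cdot>\<^bsub>C\<^esub> f \<longrightarrow> g = h)"

definition is_mono :: "('o, 'a, 'x) cat_scheme \<Rightarrow> 'a \<Rightarrow> bool" where
  "is_mono C f \<longleftrightarrow> f \<in> Arr C \<and>
     (\<forall>Z. \<forall>g \<in> Hom C Z (Dom C f). \<forall>h \<in> Hom C Z (Dom C f). f \<cdot>\<^bsub>C\<^esub> g = f \<cdot>\<^bsub>C\<^esub> h \<longrightarrow> g = h)"

definition is_iso :: "('o, 'a, 'x) cat_scheme \<Rightarrow> 'a \<Rightarrow> bool" where
  "is_iso C f \<longleftrightarrow> f \<in> Arr C \<and>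
     (\<exists>g \<in> Hom C (Cod C f) (Dom C f). g \<cdot>\<^bsub>C\<^esub> f = Id C (Dom C f) \<and> f \<cdot>\<^bsub>C\<^esub> g = Id C (Cod C f))"

text \<open>\<open>p\<close> is a pullback of \<open>n\<close> along \<open>f\<close>, with second projection \<open>q\<close>.\<close>

definition is_pullback :: "('o, 'a, 'x) cat_scheme \<Rightarrow> 'a \<Rightarrow> 'a \<Rightarrow> 'a \<Rightarrow> 'a \<Rightarrow> bool" where
  "is_pullback C f n p q \<longleftrightarrow>
     f \<in> Arr C \<and> n \<in> Arr C \<and> Cod C f = Cod C n \<and>
     p \<in> Hom C (Dom C p) (Dom C f) \<and> q \<in> Hom C (Dom C p) (Dom C n) \<and>
     f \<cdot>\<^bsub>C\<^esub> p = n \<cdot>\<^bsub>C\<^esub> q \<and>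
     (\<forall>Z. \<forall>a \<in> Hom C Z (Dom C f). \<forall>b \<in> Hom C Z (Dom C n). f \<cdot>\<^bsub>C\<^esub> a = n \<cdot>\<^bsub>C\<^esub> b \<longrightarrow>
        (\<exists>!t. t \<in> Hom C Z (Dom C p) \<and> p \<cdot>\<^bsub>C\<^esub> t = a \<and> q \<cdot>\<^bsub>C\<^esub> t = b))"

definition factors_through :: "('o, 'a, 'x) cat_scheme \<Rightarrow> 'a \<Rightarrow> 'a \<Rightarrow> bool" where
  "factors_through C n m \<longleftrightarrow> (\<exists>j \<in> Hom C (Dom C n) (Dom C m). m \<cdot>\<^bsub>C\<^esub> j = n)"

definition is_intersection :: "('o, 'a, 'x) cat_scheme \<Rightarrow> 'o \<Rightarrow> 'a set \<Rightarrow> 'a \<Rightarrow> bool" where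
  "is_intersection C X B m \<longleftrightarrow>
     m \<in> Arr C \<and> Cod C m = X \<and> (\<forall>b \<in> B. factors_through C m b) \<and>
     (\<forall>Z. \<forall>g \<in> Hom C Z X. (\<forall>b \<in> B. factors_through C g b) \<longrightarrow>
        (\<exists>!t. t \<in> Hom C Z (Dom C m) \<and> m \<cdot>\<^bsub>C\<^esub> t = g))"

section \<open>Factorization systems and subobjects\<close>

locale proper_factorization_system = category C for C (structure) +
  fixes E M :: "'b set"
  assumes E_epi: "e \<in> E \<Longrightarrow> is_epi C e"
    and M_mono: "m \<in> M \<Longrightarrow> is_mono C m"
    and E_iso: "\<lbrakk>e \<in> E; is_iso C h; Dom C h = Cod C e\<rbrakk> \<Longrightarrow> h \<cdot> e \<in> E"
    and M_iso: "\<lbrakk>m \<in> M; is_iso C h; Cod C h = Dom C m\<rbrakk> \<Longrightarrow> m \<cdot> h \<in> M"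
    and factorization: "f \<in> Arr C \<Longrightarrow> \<exists>e \<in> E. \<exists>m \<in> M. Cod C e = Dom C m \<and> m \<cdot> e = f
                           \<and> Dom C e = Dom C f \<and> Cod C m = Cod C f"
    and diagonal: "\<lbrakk>e \<in> E; m \<in> M; f \<in> Hom C (Dom C e) (Dom C m);
                      g \<in> Hom C (Cod C e) (Cod C m); g \<cdot> e = m \<cdot> f\<rbrakk>
                    \<Longrightarrow> \<exists>!d. d \<in> Hom C (Cod C e) (Dom C m) \<and> d \<cdot> e = f \<and> m \<cdot> d = g"

definition msub :: "('o, 'a, 'x) cat_scheme \<Rightarrow> 'a set \<Rightarrow> 'o \<Rightarrow> 'a set" where
  "msub C M X = {m \<in> M. Cod C m = X}"

locale M_complete_category = proper_factorization_system C E M for C (structure) and E M +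
  assumes M_pullback: "\<lbrakk>f \<in> Arr C; n \<in> msub C M (Cod C f)\<rbrakk> \<Longrightarrow>
                          \<exists>p \<in> M. \<exists>q. is_pullback C f n p q"
    and M_intersection: "\<lbrakk>X \<in> Obj C; B \<subseteq> msub C M X\<rbrakk> \<Longrightarrow> \<exists>m \<in> M. is_intersection C X B m"

text \<open>Isomorphic subobjects are identified: a subobject of \<open>X\<close> is an isomorphism class of
  \<open>M\<close>-morphisms with codomain \<open>X\<close>.\<close>

definition sub_iso :: "('o, 'a, 'x) cat_scheme \<Rightarrow> 'a set \<Rightarrow> 'o \<Rightarrow> ('a \<times> 'a) set" where
  "sub_iso C M X = {(m, n). m \<in> msub C M X \<and> n \<in> msub C M X \<and>
     (\<exists>j \<in> Hom C (Dom C m) (Dom C n). is_iso C j \<and> n \<cdot>\<^bsub>C\<^esub> j = m)}"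

definition sub :: "('o, 'a, 'x) cat_scheme \<Rightarrow> 'a set \<Rightarrow> 'o \<Rightarrow> 'a set gorder" where
  "sub C M X = \<lparr>carrier = msub C M X // sub_iso C M X, eq = (=),
     le = (\<lambda>P Q. \<exists>n \<in> P. \<exists>m \<in> Q. factors_through C n m)\<rparr>"

text \<open>The images \<open>n\<close> of \<open>f \<cdot> m\<close> (\<open>m\<close> in the class \<open>P\<close>) are determined up to isomorphism; the set
  of all of them is the subobject \<open>f(P)\<close>. Likewise for pullbacks.\<close>

definition sub_image :: "('o, 'a, 'x) cat_scheme \<Rightarrow> 'a set \<Rightarrow> 'a set \<Rightarrow> 'a \<Rightarrow> 'a set \<Rightarrow> 'a set" where
  "sub_image C E M f P =
     {n \<in> msub C M (Cod C f). \<exists>m \<in> P. \<exists>e \<in> E. e \<in> Hom C (Dom C m) (Dom C n) \<and>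
        n \<cdot>\<^bsub>C\<^esub> e = f \<cdot>\<^bsub>C\<^esub> m}"

definition sub_preimage :: "('o, 'a, 'x) cat_scheme \<Rightarrow> 'a set \<Rightarrow> 'a \<Rightarrow> 'a set \<Rightarrow> 'a set" where
  "sub_preimage C M f Q = {p \<in> msub C M (Dom C f). \<exists>n \<in> Q. \<exists>q. is_pullback C f n p q}"

section \<open>Topogenous orders and syntopogenous structures\<close>

definition T1 :: "('o, 'a, 'x) cat_scheme \<Rightarrow> 'a set \<Rightarrow> 'o \<Rightarrow> 'a set rel \<Rightarrow> bool" where
  "T1 C M X r \<longleftrightarrow> (\<forall>m n. (m, n) \<in> r \<longrightarrow> m \<sqsubseteq>\<^bsub>sub C M X\<^esub> n)"

definition T2 :: "('o, 'a, 'x) cat_scheme \<Rightarrow> 'a set \<Rightarrow> 'o \<Rightarrow> 'a set rel \<Rightarrow> bool" where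
  "T2 C M X r \<longleftrightarrow>
     (\<forall>m \<in> carrier (sub C M X). \<forall>n \<in> carrier (sub C M X).
      \<forall>p \<in> carrier (sub C M X). \<forall>q \<in> carrier (sub C M X).
        m \<sqsubseteq>\<^bsub>sub C M X\<^esub> n \<longrightarrow> (n, p) \<in> r \<longrightarrow> p \<sqsubseteq>\<^bsub>sub C M X\<^esub> q \<longrightarrow> (m, q) \<in> r)"

definition sub_relation :: "('o, 'a, 'x) cat_scheme \<Rightarrow> 'a set \<Rightarrow> 'o \<Rightarrow> 'a set rel \<Rightarrow> bool" where
  "sub_relation C M X r \<longleftrightarrow> r \<subseteq> carrier (sub C M X) \<times> carrier (sub C M X)"

definition topogenous_order ::
    "('o, 'a, 'x) cat_scheme \<Rightarrow> 'a set \<Rightarrow> ('o \<Rightarrow> 'a set rel) \<Rightarrow> bool" where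
  "topogenous_order C M T \<longleftrightarrow>
     (\<forall>X \<in> Obj C. sub_relation C M X (T X) \<and> T1 C M X (T X) \<and> T2 C M X (T X)) \<and>
     (\<forall>f \<in> Arr C. \<forall>m n. (m, n) \<in> T (Cod C f) \<longrightarrow>
        (sub_preimage C M f m, sub_preimage C M f n) \<in> T (Dom C f))"

definition meet_preserving :: "('o, 'a, 'x) cat_scheme \<Rightarrow> 'a set \<Rightarrow> 'o \<Rightarrow> 'a set rel \<Rightarrow> bool" where
  "meet_preserving C M X r \<longleftrightarrow>
     (\<forall>m \<in> carrier (sub C M X). \<forall>N \<subseteq> carrier (sub C M X).
        (\<forall>n \<in> N. (m, n) \<in> r) \<longrightarrow> (m, \<Sqinter>\<^bsub>sub C M X\<^esub> N) \<in> r)"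

definition interpolates :: "'b rel \<Rightarrow> bool" where
  "interpolates r \<longleftrightarrow> (\<forall>m n. (m, n) \<in> r \<longrightarrow> (\<exists>p. (m, p) \<in> r \<and> (p, n) \<in> r))"

definition syntopogenous_structure ::
    "('o, 'a, 'x) cat_scheme \<Rightarrow> 'a set \<Rightarrow> ('o \<Rightarrow> 'a set rel set) \<Rightarrow> bool" where
  "syntopogenous_structure C M S \<longleftrightarrow>
     (\<forall>X \<in> Obj C. \<forall>r \<in> S X. sub_relation C M X r \<and> T1 C M X r \<and> T2 C M X r) \<and>
     (\<forall>X \<in> Obj C. S X \<noteq> {} \<and> (\<forall>r \<in> S X. \<forall>s \<in> S X. \<exists>t \<in> S X. r \<subseteq> t \<and> s \<subseteq> t)) \<and>
     topogenous_order C M (\<lambda>X. \<Union>(S X)) \<and> (\<forall>X \<in> Obj C. interpolates (\<Union>(S X)))"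

definition co_perfect ::
    "('o, 'a, 'x) cat_scheme \<Rightarrow> 'a set \<Rightarrow> ('o \<Rightarrow> 'a set rel set) \<Rightarrow> bool" where
  "co_perfect C M S \<longleftrightarrow> (\<forall>X \<in> Obj C. \<forall>r \<in> S X. meet_preserving C M X r)"

definition interpolative ::
    "('o, 'a, 'x) cat_scheme \<Rightarrow> ('o \<Rightarrow> 'a set rel set) \<Rightarrow> bool" where
  "interpolative C S \<longleftrightarrow> (\<forall>X \<in> Obj C. \<forall>r \<in> S X. interpolates r)"

definition S_initial ::
    "('o, 'a, 'x) cat_scheme \<Rightarrow> 'a set \<Rightarrow> 'a set \<Rightarrow> ('o \<Rightarrow> 'a set rel set) \<Rightarrow> 'a \<Rightarrow> bool" where
  "S_initial C E M S f \<longleftrightarrow>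
     (\<forall>r \<in> S (Dom C f). \<exists>s \<in> S (Cod C f). \<forall>m n. (m, n) \<in> r \<longrightarrow>
        (\<exists>p \<in> carrier (sub C M (Cod C f)).
           (sub_image C E M f m, p) \<in> s \<and> sub_preimage C M f p \<sqsubseteq>\<^bsub>sub C M (Dom C f)\<^esub> n))"

section \<open>Faithful fibrations\<close>

locale cat_functor = dom: category A + cod: category C for A and C +
  fixes Fo :: "'o1 \<Rightarrow> 'o2" and Fa :: "'a1 \<Rightarrow> 'a2"
  assumes Fo_Obj: "X \<in> Obj A \<Longrightarrow> Fo X \<in> Obj C"
    and Fa_Hom: "f \<in> Hom A X Y \<Longrightarrow> Fa f \<in> Hom C (Fo X) (Fo Y)"
    and Fa_Id: "X \<in> Obj A \<Longrightarrow> Fa (Id A X) = Id C (Fo X)"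
    and Fa_Comp: "\<lbrakk>f \<in> Hom A X Y; g \<in> Hom A Y Z\<rbrakk> \<Longrightarrow> Fa (g \<cdot>\<^bsub>A\<^esub> f) = Fa g \<cdot>\<^bsub>C\<^esub> Fa f"

locale faithful_functor = cat_functor +
  assumes faithful: "inj_on Fa (Hom A X Y)"

definition Ini :: "('o1, 'a1, 'x) cat_scheme \<Rightarrow> ('o2, 'a2, 'y) cat_scheme \<Rightarrow>
    ('o1 \<Rightarrow> 'o2) \<Rightarrow> ('a1 \<Rightarrow> 'a2) \<Rightarrow> 'a1 set" where
  "Ini A C Fo Fa = {f \<in> Arr A.
     \<forall>Z \<in> Obj A. \<forall>h \<in> Hom A Z (Cod A f). \<forall>u \<in> Hom C (Fo Z) (Fo (Dom A f)).
       Fa f \<cdot>\<^bsub>C\<^esub> u = Fa h \<longrightarrow> (\<exists>!v. v \<in> Hom A Z (Dom A f) \<and> Fa v = u \<and> f \<cdot>\<^bsub>A\<^esub> v = h)}"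

locale faithful_M_fibration = faithful_functor +
  fixes M
  assumes initial_lifting:
    "\<lbrakk>Y \<in> Obj A; g \<in> M; Cod C g = Fo Y\<rbrakk> \<Longrightarrow> \<exists>f \<in> Ini A C Fo Fa. Cod A f = Y \<and> Fa f = g"

definition E_lift :: "('o1, 'a1, 'x) cat_scheme \<Rightarrow> ('a1 \<Rightarrow> 'a2) \<Rightarrow> 'a2 set \<Rightarrow> 'a1 set" where
  "E_lift A Fa E = {f \<in> Arr A. Fa f \<in> E}"

definition M_lift :: "('o1, 'a1, 'x) cat_scheme \<Rightarrow> ('o2, 'a2, 'y) cat_scheme \<Rightarrow>
    ('o1 \<Rightarrow> 'o2) \<Rightarrow> ('a1 \<Rightarrow> 'a2) \<Rightarrow> 'a2 set \<Rightarrow> 'a1 set" where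
  "M_lift A C Fo Fa M = {f \<in> Arr A. Fa f \<in> M} \<inter> Ini A C Fo Fa"

text \<open>\<open>sub_map C M Fo Fa X\<close> sends the class of \<open>m\<close> to the class of \<open>F m\<close> in \<open>sub (F X)\<close>
  (the map usually written \<open>\<gamma>\<^sub>X\<close>).\<close>

definition sub_map :: "('o2, 'a2, 'y) cat_scheme \<Rightarrow> 'a2 set \<Rightarrow>
    ('o1 \<Rightarrow> 'o2) \<Rightarrow> ('a1 \<Rightarrow> 'a2) \<Rightarrow> 'o1 \<Rightarrow> 'a1 set \<Rightarrow> 'a2 set" where
  "sub_map C M Fo Fa X P = (\<Union>m \<in> P. sub_iso C M (Fo X) `` {Fa m})"

definition lift_relation :: "('o1, 'a1, 'x) cat_scheme \<Rightarrow> ('o2, 'a2, 'y) cat_scheme \<Rightarrow> 'a2 set \<Rightarrow>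
    ('o1 \<Rightarrow> 'o2) \<Rightarrow> ('a1 \<Rightarrow> 'a2) \<Rightarrow> 'o1 \<Rightarrow> 'a2 set rel \<Rightarrow> 'a1 set rel" where
  "lift_relation A C M Fo Fa X r =
     {(m, n). m \<in> carrier (sub A (M_lift A C Fo Fa M) X) \<and>
              n \<in> carrier (sub A (M_lift A C Fo Fa M) X) \<and>
              (sub_map C M Fo Fa X m, sub_map C M Fo Fa X n) \<in> r}"

definition lift_structure :: "('o1, 'a1, 'x) cat_scheme \<Rightarrow> ('o2, 'a2, 'y) cat_scheme \<Rightarrow> 'a2 set \<Rightarrow>
    ('o1 \<Rightarrow> 'o2) \<Rightarrow> ('a1 \<Rightarrow> 'a2) \<Rightarrow> ('o2 \<Rightarrow> 'a2 set rel set) \<Rightarrow> 'o1 \<Rightarrow> 'a1 set rel set" where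
  "lift_structure A C M Fo Fa S X = lift_relation A C M Fo Fa X ` S (Fo X)"

end

theory Submission
  imports Defs
begin

text \<open>Everything is expressed through the relation ``\<open>g\<close> factors through \<open>m\<close>'' for \<open>m \<in> M\<close>:
  isomorphism of subobjects is mutual factorization, and the pullback \<open>p\<close> of \<open>n\<close> along \<open>f\<close> is
  characterised by: \<open>g\<close> factors through \<open>p\<close> iff \<open>f \<cdot> g\<close> factors through \<open>n\<close>; similarly for images
  and intersections. For \<open>m\<close> initial, \<open>g\<close> factors through \<open>m\<close> iff \<open>F g\<close> factors through \<open>F m\<close>.
  Hence \<open>M\<close>-completeness lifts from \<open>C\<close> to \<open>A\<close>, and \<open>\<gamma>\<close> is an order isomorphism that commutes with
  images, preimages and meets, so every axiom on \<open>S\<close> transports along it.\<close>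

section \<open>Subobjects as classes of mutual factorization\<close>

context category
begin

lemma HomD:
  assumes "f \<in> Hom C X Y"
  shows "f \<in> Arr C" "Dom C f = X" "Cod C f = Y" "X \<in> Obj C" "Y \<in> Obj C"
  using assms Dom_Obj Cod_Obj by (auto simp: Hom_def)

lemma HomI: "f \<in> Arr C \<Longrightarrow> f \<in> Hom C (Dom C f) (Cod C f)"
  by (simp add: Hom_def)

lemma is_isoI:
  assumes "f \<in> Hom C X Y" "g \<in> Hom C Y X" "g \<cdot> f = Id C X" "f \<cdot> g = Id C Y"
  shows "is_iso C f"
  using assms HomD[OF assms(1)] by (auto simp: is_iso_def)

lemma is_isoE:
  assumes "is_iso C f"
  obtains g where "g \<in> Hom C (Cod C f) (Dom C f)" "g \<cdot> f = Id C (Dom C f)"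
    "f \<cdot> g = Id C (Cod C f)"
  using assms by (auto simp: is_iso_def)

lemma factors_throughI:
  assumes "j \<in> Hom C (Dom C n) (Dom C m)" "m \<cdot> j = n"
  shows "factors_through C n m"
  using assms by (auto simp: factors_through_def)

lemma factors_throughE:
  assumes "factors_through C n m"
  obtains j where "j \<in> Hom C (Dom C n) (Dom C m)" "m \<cdot> j = n"
  using assms by (auto simp: factors_through_def)

lemma factors_through_refl: "m \<in> Arr C \<Longrightarrow> factors_through C m m"
  using factors_throughI[OF Id_Hom[OF Dom_Obj]] Comp_Id[OF HomI] by blast

lemma factors_through_trans:
  assumes "factors_through C a b" "factors_through C b c" "c \<in> Arr C"
  shows "factors_through C a c"
proof -
  obtain i where i: "i \<in> Hom C (Dom C a) (Dom C b)" "b \<cdot> i = a"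
    using assms(1) by (rule factors_throughE)
  obtain j where j: "j \<in> Hom C (Dom C b) (Dom C c)" "c \<cdot> j = b"
    using assms(2) by (rule factors_throughE)
  have "c \<cdot> (j \<cdot> i) = a"
    using Comp_assoc[OF i(1) j(1) HomI[OF assms(3)]] i j by simp
  then show ?thesis
    using Comp_Hom[OF i(1) j(1)] by (rule factors_throughI[rotated])
qed

lemma factors_through_precomp:
  assumes "factors_through C g m" "m \<in> Arr C" "g \<in> Hom C X Y" "h \<in> Hom C W X"
  shows "factors_through C (g \<cdot> h) m"
proof -
  have "factors_through C (g \<cdot> h) g"
    using assms HomD[OF assms(3)] HomD[OF Comp_Hom[OF assms(4,3)]]
    by (auto intro: factors_throughI)
  then show ?thesis using assms factors_through_trans by blast
qed

lemma factors_through_postcomp: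
  assumes "factors_through C g m" "m \<in> Hom C X Y" "f \<in> Hom C Y Z"
  shows "factors_through C (f \<cdot> g) (f \<cdot> m)"
proof -
  obtain j where j: "j \<in> Hom C (Dom C g) (Dom C m)" "m \<cdot> j = g"
    using assms(1) by (rule factors_throughE)
  have j': "j \<in> Hom C (Dom C g) X" using j HomD[OF assms(2)] by simp
  have fg: "f \<cdot> g = (f \<cdot> m) \<cdot> j"
    using Comp_assoc[OF j' assms(2,3)] j by simp
  have "f \<cdot> m \<in> Hom C X Z" using Comp_Hom[OF assms(2,3)] .
  then have "Dom C (f \<cdot> m) = X" "Dom C (f \<cdot> g) = Dom C g"
    using HomD[OF \<open>f \<cdot> m \<in> Hom C X Z\<close>] Comp_Hom[OF j', of "f \<cdot> m" Z] fg
    by (auto simp: Hom_def)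
  then show ?thesis using fg j' by (auto intro!: factors_throughI)
qed

lemma is_monoD:
  assumes "is_mono C m" "g \<in> Hom C Z (Dom C m)" "h \<in> Hom C Z (Dom C m)" "m \<cdot> g = m \<cdot> h"
  shows "g = h"
  using assms by (auto simp: is_mono_def)

text \<open>Cancelling the monos \<open>m\<close> and \<open>n\<close> on the left turns the round
  trips \<open>i \<cdot> j\<close> and \<open>j \<cdot> i\<close> of the two comparison arrows into
  identities.\<close>

lemma mutual_factorization_is_iso:
  assumes "is_mono C m" "is_mono C n" "factors_through C n m"
    "j \<in> Hom C (Dom C m) (Dom C n)" "n \<cdot> j = m"
  shows "is_iso C j"
proof -
  obtain i where i: "i \<in> Hom C (Dom C n) (Dom C m)" "m \<cdot> i = n"
    using assms(3) by (rule factors_throughE)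
  have m: "m \<in> Hom C (Dom C m) (Cod C m)" and n: "n \<in> Hom C (Dom C n) (Cod C n)"
    using assms by (auto simp: is_mono_def intro: HomI)
  have "m \<cdot> (i \<cdot> j) = m \<cdot> Id C (Dom C m)"
    using Comp_assoc[OF assms(4) i(1) m] i assms(5) Comp_Id[OF m] by simp
  then have "i \<cdot> j = Id C (Dom C m)"
    using is_monoD[OF assms(1) Comp_Hom[OF assms(4) i(1)]] Id_Hom HomD(4)[OF m] by blast
  moreover have "n \<cdot> (j \<cdot> i) = n \<cdot> Id C (Dom C n)"
    using Comp_assoc[OF i(1) assms(4) n] i assms(5) Comp_Id[OF n] by simp
  then have "j \<cdot> i = Id C (Dom C n)"
    using is_monoD[OF assms(2) Comp_Hom[OF i(1) assms(4)]] Id_Hom HomD(4)[OF n] by blast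
  ultimately show ?thesis using is_isoI[OF assms(4) i(1)] by blast
qed

end

section \<open>The poset of subobjects\<close>

context proper_factorization_system
begin

lemma msub_Hom: "m \<in> msub C M X \<Longrightarrow> m \<in> Hom C (Dom C m) X"
  using M_mono by (auto simp: msub_def is_mono_def Hom_def)

lemma msub_mono: "m \<in> msub C M X \<Longrightarrow> is_mono C m"
  using M_mono by (auto simp: msub_def)

lemma msub_Arr: "m \<in> msub C M X \<Longrightarrow> m \<in> Arr C"
  using msub_mono by (auto simp: is_mono_def)

text \<open>Composing with the inverse of the comparison arrow gives the second factorization;
  conversely, monicity makes the comparison arrow invertible. In this form the laws of an
  equivalence relation are immediate.\<close>

lemma sub_iso_iff:
  "(m, n) \<in> sub_iso C M X \<longleftrightarrow>
     m \<in> msub C M X \<and> n \<in> msub C M X \<and> factors_through C m n \<and> factors_through C n m"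
proof
  assume "(m, n) \<in> sub_iso C M X"
  then obtain j where mn: "m \<in> msub C M X" "n \<in> msub C M X"
    and j: "j \<in> Hom C (Dom C m) (Dom C n)" "is_iso C j" "n \<cdot> j = m"
    by (auto simp: sub_iso_def)
  obtain i where i: "i \<in> Hom C (Dom C n) (Dom C m)" "j \<cdot> i = Id C (Dom C n)"
    using is_isoE[OF j(2)] HomD[OF j(1)] by metis
  have "m \<cdot> i = n"
    using Comp_assoc[OF i(1) j(1) msub_Hom[OF mn(2)]] i j Comp_Id[OF msub_Hom[OF mn(2)]] by simp
  then show "m \<in> msub C M X \<and> n \<in> msub C M X \<and> factors_through C m n \<and> factors_through C n m"
    using mn i j by (auto intro: factors_throughI)
next
  assume *: "m \<in> msub C M X \<and> n \<in> msub C M X \<and> factors_through C m n \<and> factors_through C n m"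
  then obtain j where j: "j \<in> Hom C (Dom C m) (Dom C n)" "n \<cdot> j = m"
    by (auto elim: factors_throughE)
  then have "is_iso C j"
    using * mutual_factorization_is_iso msub_mono by blast
  then show "(m, n) \<in> sub_iso C M X"
    using * j by (auto simp: sub_iso_def)
qed

lemma equiv_sub_iso: "equiv (msub C M X) (sub_iso C M X)"
proof (rule equivI)
  show "sub_iso C M X \<subseteq> msub C M X \<times> msub C M X"
    by (auto simp: sub_iso_def)
  show "refl_on (msub C M X) (sub_iso C M X)"
    by (auto simp: refl_on_def sub_iso_iff intro: factors_through_refl msub_Arr)
  show "sym (sub_iso C M X)"
    by (auto simp: sym_def sub_iso_iff)
  show "trans (sub_iso C M X)"
    by (rule transI) (meson sub_iso_iff factors_through_trans msub_Arr)
qed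

text \<open>Names the elements of the carrier by representatives, so that statements about
  subobjects reduce to statements about arrows. Outside \<open>msub C M X\<close> the value is the
  empty set.\<close>

definition sub_class :: "'a \<Rightarrow> 'b \<Rightarrow> 'b set" where
  "sub_class X m = sub_iso C M X `` {m}"

lemma sub_class_eq:
  "sub_class X m = {n \<in> msub C M X. m \<in> msub C M X \<and> factors_through C m n \<and> factors_through C n m}"
  by (auto simp: sub_class_def sub_iso_iff)

lemma sub_class_self: "m \<in> msub C M X \<Longrightarrow> m \<in> sub_class X m"
  by (auto simp: sub_class_eq intro: factors_through_refl msub_Arr)

lemma sub_class_eqI:
  assumes "m \<in> msub C M X" "n \<in> msub C M X" "factors_through C m n" "factors_through C n m"
  shows "sub_class X m = sub_class X n"
  unfolding sub_class_def using assms sub_iso_iff equiv_class_eq[OF equiv_sub_iso] by blast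

lemma sub_carrier: "carrier (sub C M X) = sub_class X ` msub C M X"
  by (auto simp: sub_def quotient_def sub_class_def)

lemma sub_class_carrier: "m \<in> msub C M X \<Longrightarrow> sub_class X m \<in> carrier (sub C M X)"
  by (auto simp: sub_carrier)

lemma sub_carrierE:
  assumes "P \<in> carrier (sub C M X)"
  obtains m where "m \<in> msub C M X" "P = sub_class X m"
  using assms by (auto simp: sub_carrier)

text \<open>The existential choice of representatives in \<open>le\<close> is harmless: passing to
  an equivalent representative only composes further factorizations.\<close>

lemma sub_le_iff:
  assumes "m \<in> msub C M X" "n \<in> msub C M X"
  shows "sub_class X m \<sqsubseteq>\<^bsub>sub C M X\<^esub> sub_class X n \<longleftrightarrow> factors_through C m n"
proof
  assume "sub_class X m \<sqsubseteq>\<^bsub>sub C M X\<^esub> sub_class X n"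
  then show "factors_through C m n"
    by (simp add: sub_def sub_class_eq) (meson assms factors_through_trans msub_Arr)
next
  assume "factors_through C m n"
  then show "sub_class X m \<sqsubseteq>\<^bsub>sub C M X\<^esub> sub_class X n"
    using sub_class_self[OF assms(1)] sub_class_self[OF assms(2)] by (auto simp: sub_def)
qed

text \<open>Antisymmetry is where the identification of isomorphic subobjects enters: mutual
  factorization makes the classes literally equal. It later makes meets unique.\<close>

lemma sub_partial_order: "partial_order (sub C M X)"
proof
  fix P Q R
  assume P: "P \<in> carrier (sub C M X)"
  then obtain m where m: "m \<in> msub C M X" "P = sub_class X m" by (rule sub_carrierE)
  show "P \<sqsubseteq>\<^bsub>sub C M X\<^esub> P"
    using m sub_le_iff factors_through_refl msub_Arr by metis
  assume Q: "Q \<in> carrier (sub C M X)"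
  then obtain n where n: "n \<in> msub C M X" "Q = sub_class X n" by (rule sub_carrierE)
  show "P .=\<^bsub>sub C M X\<^esub> Q" if "P \<sqsubseteq>\<^bsub>sub C M X\<^esub> Q" "Q \<sqsubseteq>\<^bsub>sub C M X\<^esub> P"
  proof -
    have "P = Q"
      using that sub_le_iff[OF m(1) n(1)] sub_le_iff[OF n(1) m(1)] sub_class_eqI[OF m(1) n(1)] m(2) n(2)
      by simp
    then show ?thesis by (simp add: sub_def)
  qed
  assume R: "R \<in> carrier (sub C M X)"
  then obtain k where k: "k \<in> msub C M X" "R = sub_class X k" by (rule sub_carrierE)
  show "P \<sqsubseteq>\<^bsub>sub C M X\<^esub> R" if "P \<sqsubseteq>\<^bsub>sub C M X\<^esub> Q" "Q \<sqsubseteq>\<^bsub>sub C M X\<^esub> R"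
    using that sub_le_iff[OF m(1) n(1)] sub_le_iff[OF n(1) k(1)] sub_le_iff[OF m(1) k(1)] m(2) n(2) k(2)
      factors_through_trans[OF _ _ msub_Arr[OF k(1)]] by blast
qed (auto simp: sub_def)

section \<open>Pullbacks, images and intersections described by factorization\<close>

lemma pullback_factors_iff:
  assumes pb: "is_pullback C f n p q" and g: "g \<in> Hom C Z (Dom C f)"
  shows "factors_through C g p \<longleftrightarrow> factors_through C (f \<cdot> g) n"
proof -
  have f: "f \<in> Hom C (Dom C f) (Cod C f)" and n: "n \<in> Hom C (Dom C n) (Cod C f)"
    and p: "p \<in> Hom C (Dom C p) (Dom C f)" and q: "q \<in> Hom C (Dom C p) (Dom C n)"
    and eq: "f \<cdot> p = n \<cdot> q"
    using pb by (auto simp: is_pullback_def Hom_def)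
  have dg: "Dom C g = Z" "Dom C (f \<cdot> g) = Z"
    using HomD[OF g] HomD[OF Comp_Hom[OF g f]] by auto
  show ?thesis
  proof
    assume "factors_through C g p"
    then have "factors_through C (f \<cdot> g) (f \<cdot> p)"
      using factors_through_postcomp p f by blast
    moreover have "factors_through C (f \<cdot> p) n"
      using q eq HomD[OF Comp_Hom[OF p f]] by (auto intro: factors_throughI)
    ultimately show "factors_through C (f \<cdot> g) n"
      using factors_through_trans HomD(1)[OF n] by blast
  next
    assume "factors_through C (f \<cdot> g) n"
    then obtain b where b: "b \<in> Hom C Z (Dom C n)" "n \<cdot> b = f \<cdot> g"
      using dg by (auto elim: factors_throughE)
    then obtain t where "t \<in> Hom C Z (Dom C p)" "p \<cdot> t = g"
      using pb g unfolding is_pullback_def by metis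
    then show "factors_through C g p"
      using dg by (auto intro: factors_throughI)
  qed
qed

text \<open>For monos the existence of factorizations already amounts to the universal property:
  monicity of \<open>n\<close> makes the second triangle commute, and monicity of \<open>p\<close>
  makes the mediating arrow unique.\<close>

lemma pullbackI:
  assumes f: "f \<in> Arr C" and n: "n \<in> msub C M (Cod C f)" and p: "p \<in> msub C M (Dom C f)"
    and char: "\<And>Z g. g \<in> Hom C Z (Dom C f) \<Longrightarrow>
      factors_through C g p \<longleftrightarrow> factors_through C (f \<cdot> g) n"
  shows "\<exists>q. is_pullback C f n p q"
proof -
  note pH = msub_Hom[OF p] and nH = msub_Hom[OF n] and fH = HomI[OF f]
  \<comment> \<open>The second projection is not given; it comes from applying the criterion to
    \<open>g = p\<close> itself.\<close>
  have "factors_through C (f \<cdot> p) n"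
    using char[OF pH] factors_through_refl[OF msub_Arr[OF p]] by blast
  then obtain q where q: "q \<in> Hom C (Dom C p) (Dom C n)" "n \<cdot> q = f \<cdot> p"
    using HomD[OF Comp_Hom[OF pH fH]] by (auto elim: factors_throughE)
  have "\<exists>!t. t \<in> Hom C Z (Dom C p) \<and> p \<cdot> t = a \<and> q \<cdot> t = b"
    if a: "a \<in> Hom C Z (Dom C f)" and b: "b \<in> Hom C Z (Dom C n)" and ab: "f \<cdot> a = n \<cdot> b" for Z a b
  proof -
    have "factors_through C (f \<cdot> a) n"
      using b ab HomD[OF Comp_Hom[OF a fH]] by (auto intro: factors_throughI)
    then obtain t where t: "t \<in> Hom C Z (Dom C p)" "p \<cdot> t = a"
      using char[OF a] HomD[OF a] by (auto elim: factors_throughE)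
    have "n \<cdot> (q \<cdot> t) = n \<cdot> b"
      using Comp_assoc[OF t(1) q(1) nH] Comp_assoc[OF t(1) pH fH] q t ab by simp
    then have "q \<cdot> t = b"
      using is_monoD[OF msub_mono[OF n] Comp_Hom[OF t(1) q(1)] b] by blast
    then show ?thesis
      using t is_monoD[OF msub_mono[OF p]] by blast
  qed
  then have "is_pullback C f n p q"
    using f n q pH HomD[OF nH] unfolding is_pullback_def by auto
  then show ?thesis by blast
qed

text \<open>By the factorization criterion, being a pullback depends on \<open>n\<close> and
  \<open>p\<close> only up to mutual factorization, so the pullbacks of all representatives form one
  whole class.\<close>

lemma sub_preimage_class:
  assumes f: "f \<in> Arr C" and n: "n \<in> msub C M (Cod C f)" and p: "p \<in> msub C M (Dom C f)"
    and pb: "is_pullback C f n p q"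
  shows "sub_preimage C M f (sub_class (Cod C f) n) = sub_class (Dom C f) p"
proof (intro equalityI subsetI)
  fix p' assume "p' \<in> sub_preimage C M f (sub_class (Cod C f) n)"
  then obtain n' q' where p': "p' \<in> msub C M (Dom C f)" and n': "n' \<in> sub_class (Cod C f) n"
    and pb': "is_pullback C f n' p' q'"
    by (auto simp: sub_preimage_def)
  have "factors_through C h n \<longleftrightarrow> factors_through C h n'" for h
    using n n' factors_through_trans msub_Arr unfolding sub_class_eq by blast
  then have "factors_through C g p \<longleftrightarrow> factors_through C g p'" if "g \<in> Hom C Z (Dom C f)" for Z g
    using pullback_factors_iff[OF pb that] pullback_factors_iff[OF pb' that] by simp
  \<comment> \<open>Taking \<open>g = p\<close> and \<open>g = p'\<close> in this equivalence gives
    the two factorizations.\<close>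
  then show "p' \<in> sub_class (Dom C f) p"
    using p p' msub_Hom factors_through_refl msub_Arr unfolding sub_class_eq by blast
next
  fix p' assume "p' \<in> sub_class (Dom C f) p"
  then have p': "p' \<in> msub C M (Dom C f)" "factors_through C p p'" "factors_through C p' p"
    by (auto simp: sub_class_eq)
  have "factors_through C g p' \<longleftrightarrow> factors_through C (f \<cdot> g) n"
    if "g \<in> Hom C Z (Dom C f)" for Z g
    using pullback_factors_iff[OF pb that] p p' factors_through_trans msub_Arr by blast
  then have "\<exists>q. is_pullback C f n p' q"
    using pullbackI[OF f n p'(1)] by blast
  then show "p' \<in> sub_preimage C M f (sub_class (Cod C f) n)"
    using p' sub_class_self[OF n] by (auto simp: sub_preimage_def)
qed

text \<open>The diagonal fill-in of \<open>e\<close> against \<open>k\<close> makes the image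
  \<open>n\<close> the least \<open>M\<close>-subobject through which \<open>n \<cdot> e\<close>
  factors.\<close>

lemma image_factors_iff:
  assumes e: "e \<in> E" "e \<in> Hom C W (Dom C n)" and n: "n \<in> msub C M Y" and k: "k \<in> msub C M Y"
  shows "factors_through C n k \<longleftrightarrow> factors_through C (n \<cdot> e) k"
proof
  assume "factors_through C n k"
  then show "factors_through C (n \<cdot> e) k"
    using factors_through_precomp[OF _ msub_Arr[OF k] msub_Hom[OF n] e(2)] by blast
next
  assume "factors_through C (n \<cdot> e) k"
  then obtain h where h: "h \<in> Hom C W (Dom C k)" "k \<cdot> h = n \<cdot> e"
    using HomD[OF Comp_Hom[OF e(2) msub_Hom[OF n]]] by (auto elim: factors_throughE)
  have "k \<in> M" "Cod C k = Y" using k by (auto simp: msub_def)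
  then obtain d where "d \<in> Hom C (Dom C n) (Dom C k)" "k \<cdot> d = n"
    using diagonal[OF e(1), of k h n] h HomD[OF e(2)] msub_Hom[OF n] by auto
  then show "factors_through C n k" by (rule factors_throughI)
qed

text \<open>An image is determined by the \<open>M\<close>-subobjects above it, hence up to mutual
  factorization. Conversely, closure of \<open>E\<close> under isomorphisms makes every
  representative of the class an image.\<close>

lemma sub_image_class:
  assumes f: "f \<in> Arr C" and m: "m \<in> msub C M (Dom C f)" and n: "n \<in> msub C M (Cod C f)"
    and e: "e \<in> E" "e \<in> Hom C (Dom C m) (Dom C n)" "n \<cdot> e = f \<cdot> m"
  shows "sub_image C E M f (sub_class (Dom C f) m) = sub_class (Cod C f) n"
proof (intro equalityI subsetI)
  fix n' assume "n' \<in> sub_image C E M f (sub_class (Dom C f) m)"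
  then obtain m' e' where n': "n' \<in> msub C M (Cod C f)" and m': "m' \<in> sub_class (Dom C f) m"
    and e': "e' \<in> E" "e' \<in> Hom C (Dom C m') (Dom C n')" "n' \<cdot> e' = f \<cdot> m'"
    by (auto simp: sub_image_def)
  have "factors_through C m m'" "factors_through C m' m" "m' \<in> msub C M (Dom C f)"
    using m' by (auto simp: sub_class_eq)
  then have "factors_through C (f \<cdot> m) (f \<cdot> m')" "factors_through C (f \<cdot> m') (f \<cdot> m)"
    using factors_through_postcomp msub_Hom m HomI[OF f] by blast+
  then have "factors_through C (f \<cdot> m) k \<longleftrightarrow> factors_through C (f \<cdot> m') k"
    if "k \<in> msub C M (Cod C f)" for k
    using factors_through_trans msub_Arr[OF that] by blast
  then have "factors_through C n k \<longleftrightarrow> factors_through C n' k" if "k \<in> msub C M (Cod C f)" for k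
    using image_factors_iff[OF e(1,2) n that] image_factors_iff[OF e'(1,2) n' that] e(3) e'(3) that
    by simp
  \<comment> \<open>The instances \<open>k = n\<close> and \<open>k = n'\<close> give the two
    factorizations.\<close>
  then show "n' \<in> sub_class (Cod C f) n"
    using n n' factors_through_refl msub_Arr by (auto simp: sub_class_eq)
next
  fix n' assume "n' \<in> sub_class (Cod C f) n"
  then have n': "n' \<in> msub C M (Cod C f)" "factors_through C n n'" "factors_through C n' n"
    by (auto simp: sub_class_eq)
  obtain j where j: "j \<in> Hom C (Dom C n) (Dom C n')" "n' \<cdot> j = n"
    using n'(2) by (rule factors_throughE)
  have "is_iso C j"
    using mutual_factorization_is_iso[OF msub_mono[OF n] msub_mono[OF n'(1)] n'(3) j] .
  then have "j \<cdot> e \<in> E"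
    using E_iso e HomD[OF e(2)] HomD[OF j(1)] by auto
  moreover have "n' \<cdot> (j \<cdot> e) = f \<cdot> m"
    using Comp_assoc[OF e(2) j(1) msub_Hom[OF n'(1)]] j e by simp
  ultimately show "n' \<in> sub_image C E M f (sub_class (Dom C f) m)"
    using n' sub_class_self[OF m] Comp_Hom[OF e(2) j(1)] by (auto simp: sub_image_def)
qed

lemma intersection_factors_iff:
  assumes int: "is_intersection C X B m" and B: "B \<subseteq> msub C M X" and g: "g \<in> Hom C Z X"
  shows "factors_through C g m \<longleftrightarrow> (\<forall>b\<in>B. factors_through C g b)"
proof
  assume "factors_through C g m"
  then show "\<forall>b\<in>B. factors_through C g b"
    using int B factors_through_trans msub_Arr unfolding is_intersection_def by blast
next
  assume "\<forall>b\<in>B. factors_through C g b"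
  then obtain t where "t \<in> Hom C Z (Dom C m)" "m \<cdot> t = g"
    using int g unfolding is_intersection_def by metis
  then show "factors_through C g m"
    using HomD[OF g] by (auto intro: factors_throughI)
qed

text \<open>Since \<open>m\<close> is mono, mediating arrows are unique as soon as they exist, so
  comparing factorizations is enough.\<close>

lemma intersectionI:
  assumes m: "m \<in> msub C M X"
    and char: "\<And>Z g. g \<in> Hom C Z X \<Longrightarrow>
      factors_through C g m \<longleftrightarrow> (\<forall>b\<in>B. factors_through C g b)"
  shows "is_intersection C X B m"
  unfolding is_intersection_def
proof (intro conjI allI ballI impI)
  show "m \<in> Arr C" "Cod C m = X" using HomD[OF msub_Hom[OF m]] by auto
  show "factors_through C m b" if "b \<in> B" for b
    using that char[OF msub_Hom[OF m]] factors_through_refl[OF msub_Arr[OF m]] by blast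
  fix Z g assume g: "g \<in> Hom C Z X" and "\<forall>b\<in>B. factors_through C g b"
  then have "factors_through C g m" using char by blast
  then obtain t where "t \<in> Hom C Z (Dom C m)" "m \<cdot> t = g"
    using HomD[OF g] by (auto elim: factors_throughE)
  then show "\<exists>!t. t \<in> Hom C Z (Dom C m) \<and> m \<cdot> t = g"
    using is_monoD[OF msub_mono[OF m]] by blast
qed

text \<open>The meet is defined by Hilbert choice among greatest lower bounds; antisymmetry leaves a
  single candidate.\<close>

lemma sub_inf_eqI:
  assumes "greatest (sub C M X) P (Lower (sub C M X) N)"
  shows "\<Sqinter>\<^bsub>sub C M X\<^esub> N = P"
proof -
  interpret partial_order "sub C M X" by (rule sub_partial_order)
  show ?thesis
    unfolding inf_def by (rule some_equality) (use assms greatest_unique in auto)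
qed

end

section \<open>Preimages and meets in an \<open>M\<close>-complete category\<close>

context M_complete_category
begin

lemma sub_preimage_carrier:
  assumes "f \<in> Arr C" "Q \<in> carrier (sub C M (Cod C f))"
  shows "sub_preimage C M f Q \<in> carrier (sub C M (Dom C f))"
proof -
  obtain n where n: "n \<in> msub C M (Cod C f)" "Q = sub_class (Cod C f) n"
    using assms(2) by (rule sub_carrierE)
  obtain p q where p: "p \<in> M" "is_pullback C f n p q" using M_pullback[OF assms(1) n(1)] by blast
  then have "p \<in> msub C M (Dom C f)" by (auto simp: msub_def is_pullback_def Hom_def)
  then show ?thesis using sub_preimage_class[OF assms(1) n(1) _ p(2)] n sub_class_carrier by simp
qed

text \<open>Meets of classes are represented by \<open>M\<close>-intersections of arrows, which
  exist by completeness.\<close>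

lemma sub_inf_greatest:
  assumes X: "X \<in> Obj C" and N: "N \<subseteq> carrier (sub C M X)"
  shows "greatest (sub C M X) (\<Sqinter>\<^bsub>sub C M X\<^esub> N) (Lower (sub C M X) N)"
proof -
  \<comment> \<open>All representatives of all members of \<open>N\<close> are intersected, so none
    has to be chosen; equivalent arrows impose the same condition.\<close>
  define B where "B = {b \<in> msub C M X. sub_class X b \<in> N}"
  have B: "B \<subseteq> msub C M X" by (auto simp: B_def)
  then obtain m where m: "m \<in> M" and int: "is_intersection C X B m"
    using M_intersection[OF X] by blast
  then have mX: "m \<in> msub C M X" by (auto simp: msub_def is_intersection_def)
  \<comment> \<open>Both halves of the claim are contained in this equivalence: \<open>k = m\<close>
    shows that the class of \<open>m\<close> is a lower bound, and the direction from right to left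
    shows that it is the greatest one.\<close>
  have lower: "sub_class X k \<sqsubseteq>\<^bsub>sub C M X\<^esub> sub_class X m \<longleftrightarrow>
      (\<forall>P\<in>N. sub_class X k \<sqsubseteq>\<^bsub>sub C M X\<^esub> P)" if k: "k \<in> msub C M X" for k
  proof -
    have "(\<forall>P\<in>N. sub_class X k \<sqsubseteq>\<^bsub>sub C M X\<^esub> P) \<longleftrightarrow> (\<forall>b\<in>B. factors_through C k b)"
    proof
      assume "\<forall>P\<in>N. sub_class X k \<sqsubseteq>\<^bsub>sub C M X\<^esub> P"
      then show "\<forall>b\<in>B. factors_through C k b" using sub_le_iff[OF k] by (auto simp: B_def)
    next
      assume *: "\<forall>b\<in>B. factors_through C k b"
      show "\<forall>P\<in>N. sub_class X k \<sqsubseteq>\<^bsub>sub C M X\<^esub> P"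
      proof
        fix P assume P: "P \<in> N"
        then obtain b where "b \<in> msub C M X" "P = sub_class X b" using N sub_carrierE by blast
        then show "sub_class X k \<sqsubseteq>\<^bsub>sub C M X\<^esub> P" using * sub_le_iff[OF k] P by (auto simp: B_def)
      qed
    qed
    then show ?thesis
      using intersection_factors_iff[OF int B msub_Hom[OF k]] sub_le_iff[OF k mX] by simp
  qed
  have "sub_class X m \<in> Lower (sub C M X) N"
    using lower[OF mX] sub_le_iff[OF mX mX] factors_through_refl[OF msub_Arr[OF mX]]
      sub_class_carrier[OF mX] by (auto simp: Lower_def)
  moreover have "P \<sqsubseteq>\<^bsub>sub C M X\<^esub> sub_class X m" if P: "P \<in> Lower (sub C M X) N" for P
  proof -
    obtain k where "k \<in> msub C M X" "P = sub_class X k"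
      using P by (auto simp: Lower_def elim: sub_carrierE)
    then show ?thesis using lower P N by (auto simp: Lower_def)
  qed
  ultimately have "greatest (sub C M X) (sub_class X m) (Lower (sub C M X) N)"
    by (auto simp: greatest_def)
  then show ?thesis using sub_inf_eqI by metis
qed

end

section \<open>Lifting the structure along the fibration\<close>

text \<open>The prefix \<open>base\<close> carries the subobject theory of \<open>C\<close>; the
  sublocales proved below make the same theory available for \<open>A\<close> under the prefix
  \<open>total\<close>.\<close>

locale fibration_over_M_complete = base: M_complete_category C E M + faithful_M_fibration A C Fo Fa M
  for A :: "('o1, 'a1, 'x) cat_scheme" and C :: "('o2, 'a2, 'y) cat_scheme"
    and Fo Fa and E M :: "'a2 set"
begin

abbreviation "EF \<equiv> E_lift A Fa E"
abbreviation "MF \<equiv> M_lift A C Fo Fa M"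
abbreviation "\<gamma> \<equiv> sub_map C M Fo Fa"
abbreviation "lift \<equiv> lift_relation A C M Fo Fa"

section \<open>The functor on arrows, initial arrows and representatives of subobjects\<close>

lemma Fa_Arr: "f \<in> Arr A \<Longrightarrow> Fa f \<in> Arr C"
  and Fa_Dom: "f \<in> Arr A \<Longrightarrow> Dom C (Fa f) = Fo (Dom A f)"
  and Fa_Cod: "f \<in> Arr A \<Longrightarrow> Cod C (Fa f) = Fo (Cod A f)"
  using Fa_Hom[OF dom.HomI] by (auto simp: Hom_def)

lemma faithfulD: "f \<in> Hom A X Y \<Longrightarrow> g \<in> Hom A X Y \<Longrightarrow> Fa f = Fa g \<Longrightarrow> f = g"
  using faithful by (auto simp: inj_on_def)

lemma IniE:
  assumes "f \<in> Ini A C Fo Fa" "f \<in> Hom A X Y" "h \<in> Hom A Z Y" "u \<in> Hom C (Fo Z) (Fo X)"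
    "Fa f \<cdot>\<^bsub>C\<^esub> u = Fa h"
  obtains v where "v \<in> Hom A Z X" "Fa v = u" "f \<cdot>\<^bsub>A\<^esub> v = h"
  using assms dom.HomD[OF assms(2)] dom.HomD[OF assms(3)] unfolding Ini_def by blast

text \<open>Faithfulness forces uniqueness of the lifted arrow, so existence suffices.\<close>

lemma IniI:
  assumes f: "f \<in> Hom A X Y"
    and ex: "\<And>Z h u. h \<in> Hom A Z Y \<Longrightarrow> u \<in> Hom C (Fo Z) (Fo X) \<Longrightarrow> Fa f \<cdot>\<^bsub>C\<^esub> u = Fa h \<Longrightarrow>
      \<exists>v \<in> Hom A Z X. Fa v = u \<and> f \<cdot>\<^bsub>A\<^esub> v = h"
  shows "f \<in> Ini A C Fo Fa"
  unfolding Ini_def mem_Collect_eq dom.HomD(2,3)[OF f]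
proof (intro conjI ballI impI)
  show "f \<in> Arr A" using dom.HomD[OF f] by simp
  fix Z h u assume "h \<in> Hom A Z Y" "u \<in> Hom C (Fo Z) (Fo X)" "Fa f \<cdot>\<^bsub>C\<^esub> u = Fa h"
  then obtain v where "v \<in> Hom A Z X" "Fa v = u" "f \<cdot>\<^bsub>A\<^esub> v = h" using ex by blast
  then show "\<exists>!v. v \<in> Hom A Z X \<and> Fa v = u \<and> f \<cdot>\<^bsub>A\<^esub> v = h"
    using faithfulD by blast
qed

lemma MF_D:
  assumes "m \<in> MF"
  shows "m \<in> Arr A" "Fa m \<in> M" "m \<in> Ini A C Fo Fa" "m \<in> Hom A (Dom A m) (Cod A m)"
    "Fa m \<in> Hom C (Fo (Dom A m)) (Fo (Cod A m))"
  using assms dom.HomI Fa_Hom[OF dom.HomI] by (auto simp: M_lift_def)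

lemma EF_D:
  assumes "e \<in> EF"
  shows "e \<in> Arr A" "Fa e \<in> E" "e \<in> Hom A (Dom A e) (Cod A e)"
    "Fa e \<in> Hom C (Fo (Dom A e)) (Fo (Cod A e))"
  using assms dom.HomI Fa_Hom[OF dom.HomI] by (auto simp: E_lift_def)

text \<open>An initial lifting lies strictly over \<open>n\<close>, not merely up to isomorphism,
  and belongs to \<open>MF\<close> because \<open>n\<close> is in \<open>M\<close>.\<close>

lemma msub_lift:
  assumes "X \<in> Obj A" "n \<in> msub C M (Fo X)"
  obtains m where "m \<in> msub A MF X" "Fa m = n"
proof -
  obtain m where "m \<in> Ini A C Fo Fa" "Cod A m = X" "Fa m = n"
    using initial_lifting[OF assms(1), of n] assms(2) by (auto simp: msub_def)
  then show ?thesis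
    using assms(2) that[of m] by (auto simp: msub_def M_lift_def Ini_def)
qed

lemma Fa_msub: "m \<in> msub A MF X \<Longrightarrow> Fa m \<in> msub C M (Fo X)"
  using MF_D Fa_Cod by (auto simp: msub_def)

text \<open>Functoriality gives one direction; for the other, initiality of \<open>m\<close> lifts
  the factoring arrow. This carries the factorization criteria back and forth between
  \<open>A\<close> and \<open>C\<close>.\<close>

lemma factors_through_Fa_iff:
  assumes m: "m \<in> msub A MF X" and g: "g \<in> Hom A Z X"
  shows "factors_through A g m \<longleftrightarrow> factors_through C (Fa g) (Fa m)"
proof -
  have mM: "m \<in> MF" and mH: "m \<in> Hom A (Dom A m) X"
    using m MF_D(4)[of m] by (auto simp: msub_def)
  have gD: "Dom A g = Z" "Dom C (Fa g) = Fo Z"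
    using dom.HomD[OF g] base.HomD[OF Fa_Hom[OF g]] by auto
  have mD: "Dom C (Fa m) = Fo (Dom A m)" using Fa_Dom MF_D(1)[OF mM] by simp
  show ?thesis
  proof
    assume "factors_through A g m"
    then obtain j where j: "j \<in> Hom A Z (Dom A m)" "m \<cdot>\<^bsub>A\<^esub> j = g"
      using gD by (auto elim: dom.factors_throughE)
    then have "Fa m \<cdot>\<^bsub>C\<^esub> Fa j = Fa g" using Fa_Comp[OF j(1) mH] by simp
    then show "factors_through C (Fa g) (Fa m)"
      using Fa_Hom[OF j(1)] gD mD by (auto intro: base.factors_throughI)
  next
    assume "factors_through C (Fa g) (Fa m)"
    then obtain u where "u \<in> Hom C (Fo Z) (Fo (Dom A m))" "Fa m \<cdot>\<^bsub>C\<^esub> u = Fa g"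
      using gD mD by (auto elim: base.factors_throughE)
    then obtain v where "v \<in> Hom A Z (Dom A m)" "m \<cdot>\<^bsub>A\<^esub> v = g"
      using IniE[OF MF_D(3)[OF mM] mH g] by blast
    then show "factors_through A g m"
      using gD by (auto intro: dom.factors_throughI)
  qed
qed

section \<open>The lifted factorization system\<close>

lemma is_iso_Fa:
  assumes "is_iso A h"
  shows "is_iso C (Fa h)"
proof -
  have "h \<in> Arr A" using assms by (simp add: is_iso_def)
  note h = dom.HomI[OF this]
  obtain g where g: "g \<in> Hom A (Cod A h) (Dom A h)" "g \<cdot>\<^bsub>A\<^esub> h = Id A (Dom A h)"
    "h \<cdot>\<^bsub>A\<^esub> g = Id A (Cod A h)"
    using assms by (rule dom.is_isoE)
  show ?thesis
    using g base.is_isoI[OF Fa_Hom[OF h] Fa_Hom[OF g(1)]] Fa_Comp[OF h g(1)] Fa_Comp[OF g(1) h]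
      Fa_Id dom.HomD[OF h] by simp
qed

text \<open>Factor \<open>Fa f\<close> in \<open>C\<close> and lift the \<open>M\<close>-part to an
  initial \<open>m\<close>. Since \<open>m' \<cdot> e' = Fa f\<close>, initiality of
  \<open>m\<close> then lifts \<open>e'\<close> to an arrow whose composite with \<open>m\<close> is
  \<open>f\<close>.\<close>

lemma factorization_lift:
  assumes f: "f \<in> Arr A"
  obtains e m where "e \<in> EF" "m \<in> msub A MF (Cod A f)" "e \<in> Hom A (Dom A f) (Dom A m)"
    "m \<cdot>\<^bsub>A\<^esub> e = f"
proof -
  note fH = dom.HomI[OF f]
  obtain e' m' where e': "e' \<in> E" and m': "m' \<in> M"
    and c: "Cod C e' = Dom C m'" "m' \<cdot>\<^bsub>C\<^esub> e' = Fa f" "Dom C e' = Dom C (Fa f)" "Cod C m' = Cod C (Fa f)"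
    using base.factorization[OF Fa_Arr[OF f]] by blast
  have "m' \<in> msub C M (Fo (Cod A f))" using m' c Fa_Cod[OF f] by (simp add: msub_def)
  then obtain m where m: "m \<in> msub A MF (Cod A f)" "Fa m = m'"
    using msub_lift dom.HomD(5)[OF fH] by blast
  then have mM: "m \<in> MF" and mH: "m \<in> Hom A (Dom A m) (Cod A f)"
    using MF_D(4)[of m] by (auto simp: msub_def)
  have "e' \<in> Arr C" using base.E_epi[OF e'] by (simp add: is_epi_def)
  then have "e' \<in> Hom C (Fo (Dom A f)) (Fo (Dom A m))"
    using c m Fa_Dom[OF f] Fa_Dom[OF MF_D(1)[OF mM]] by (simp add: Hom_def)
  then obtain e where e: "e \<in> Hom A (Dom A f) (Dom A m)" "Fa e = e'" "m \<cdot>\<^bsub>A\<^esub> e = f"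
    using IniE[OF MF_D(3)[OF mM] mH fH] c m by metis
  then show ?thesis
    using that[of e m] m e' dom.HomD[OF e(1)] by (auto simp: E_lift_def)
qed

text \<open>The diagonal \<open>u\<close> of the square in \<open>C\<close> is lifted by initiality
  of \<open>m\<close> against \<open>g\<close>, which yields the triangle with \<open>m\<close>. The
  triangle with \<open>e\<close> commutes after applying \<open>Fa\<close>, hence by
  faithfulness.\<close>

lemma diagonal_lift:
  assumes e: "e \<in> EF" and m: "m \<in> MF" and f: "f \<in> Hom A (Dom A e) (Dom A m)"
    and g: "g \<in> Hom A (Cod A e) (Cod A m)" and eq: "g \<cdot>\<^bsub>A\<^esub> e = m \<cdot>\<^bsub>A\<^esub> f"
  shows "\<exists>d. d \<in> Hom A (Cod A e) (Dom A m) \<and> d \<cdot>\<^bsub>A\<^esub> e = f \<and> m \<cdot>\<^bsub>A\<^esub> d = g"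
proof -
  note eH = EF_D(3)[OF e] and mH = MF_D(4)[OF m]
  have "Fa g \<cdot>\<^bsub>C\<^esub> Fa e = Fa m \<cdot>\<^bsub>C\<^esub> Fa f"
    using Fa_Comp[OF eH g] Fa_Comp[OF f mH] eq by simp
  then obtain u where u: "u \<in> Hom C (Fo (Cod A e)) (Fo (Dom A m))" "u \<cdot>\<^bsub>C\<^esub> Fa e = Fa f"
    "Fa m \<cdot>\<^bsub>C\<^esub> u = Fa g"
    using base.diagonal[OF EF_D(2)[OF e] MF_D(2)[OF m], of "Fa f" "Fa g"]
      Fa_Hom[OF f] Fa_Hom[OF g] base.HomD[OF EF_D(4)[OF e]] base.HomD[OF MF_D(5)[OF m]] by auto
  obtain d where d: "d \<in> Hom A (Cod A e) (Dom A m)" "Fa d = u" "m \<cdot>\<^bsub>A\<^esub> d = g"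
    using IniE[OF MF_D(3)[OF m] mH g u(1,3)] by blast
  have "d \<cdot>\<^bsub>A\<^esub> e = f"
    using faithfulD[OF dom.Comp_Hom[OF eH d(1)] f] Fa_Comp[OF eH d(1)] d u by simp
  then show ?thesis using d by blast
qed

text \<open>Faithful functors reflect monomorphisms; \<open>EF_epi\<close> is the dual reflection of
  epimorphisms.\<close>

lemma MF_mono: assumes "m \<in> MF" shows "is_mono A m"
  unfolding is_mono_def
proof (intro conjI allI ballI impI)
  show "m \<in> Arr A" using MF_D[OF assms] by simp
  fix Z g h assume gh: "g \<in> Hom A Z (Dom A m)" "h \<in> Hom A Z (Dom A m)" "m \<cdot>\<^bsub>A\<^esub> g = m \<cdot>\<^bsub>A\<^esub> h"
  have "Fa m \<cdot>\<^bsub>C\<^esub> Fa g = Fa m \<cdot>\<^bsub>C\<^esub> Fa h"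
    using Fa_Comp[OF _ MF_D(4)[OF assms]] gh by metis
  then have "Fa g = Fa h"
    using base.is_monoD[OF base.M_mono[OF MF_D(2)[OF assms]]] Fa_Hom[OF gh(1)] Fa_Hom[OF gh(2)]
      base.HomD(2)[OF MF_D(5)[OF assms]] by metis
  then show "g = h" using faithfulD gh by blast
qed

lemma EF_epi: assumes "e \<in> EF" shows "is_epi A e"
  unfolding is_epi_def
proof (intro conjI allI ballI impI)
  show "e \<in> Arr A" using EF_D[OF assms] by simp
  fix Z g h assume gh: "g \<in> Hom A (Cod A e) Z" "h \<in> Hom A (Cod A e) Z" "g \<cdot>\<^bsub>A\<^esub> e = h \<cdot>\<^bsub>A\<^esub> e"
  have "Fa g \<cdot>\<^bsub>C\<^esub> Fa e = Fa h \<cdot>\<^bsub>C\<^esub> Fa e"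
    using Fa_Comp[OF EF_D(3)[OF assms]] gh by metis
  then have "Fa g = Fa h"
    using base.E_epi[OF EF_D(2)[OF assms]] Fa_Hom[OF gh(1)] Fa_Hom[OF gh(2)]
      base.HomD(3)[OF EF_D(4)[OF assms]] unfolding is_epi_def by metis
  then show "g = h" using faithfulD gh by blast
qed

lemma MF_iso:
  assumes m: "m \<in> MF" and h: "is_iso A h" "Cod A h = Dom A m"
  shows "m \<cdot>\<^bsub>A\<^esub> h \<in> MF"
proof -
  note mH = MF_D(4)[OF m]
  have hH: "h \<in> Hom A (Dom A h) (Dom A m)" using h by (simp add: is_iso_def Hom_def)
  note mhH = dom.Comp_Hom[OF hH mH]
  obtain i where i: "i \<in> Hom A (Dom A m) (Dom A h)" "i \<cdot>\<^bsub>A\<^esub> h = Id A (Dom A h)"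
    "h \<cdot>\<^bsub>A\<^esub> i = Id A (Dom A m)"
    using dom.is_isoE[OF h(1)] h(2) by metis
  have "Fa (m \<cdot>\<^bsub>A\<^esub> h) \<in> M"
    using base.M_iso[OF MF_D(2)[OF m] is_iso_Fa[OF h(1)]] Fa_Comp[OF hH mH]
      base.HomD[OF MF_D(5)[OF m]] base.HomD[OF Fa_Hom[OF hH]] by simp
  moreover have "m \<cdot>\<^bsub>A\<^esub> h \<in> Ini A C Fo Fa"
  proof (rule IniI[OF mhH])
    fix Z k u assume k: "k \<in> Hom A Z (Cod A m)" and u: "u \<in> Hom C (Fo Z) (Fo (Dom A h))"
      and eq: "Fa (m \<cdot>\<^bsub>A\<^esub> h) \<cdot>\<^bsub>C\<^esub> u = Fa k"
    have "Fa m \<cdot>\<^bsub>C\<^esub> (Fa h \<cdot>\<^bsub>C\<^esub> u) = Fa k"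
      using base.Comp_assoc[OF u Fa_Hom[OF hH] Fa_Hom[OF mH]] eq Fa_Comp[OF hH mH] by simp
    then obtain w where w: "w \<in> Hom A Z (Dom A m)" "Fa w = Fa h \<cdot>\<^bsub>C\<^esub> u" "m \<cdot>\<^bsub>A\<^esub> w = k"
      using IniE[OF MF_D(3)[OF m] mH k base.Comp_Hom[OF u Fa_Hom[OF hH]]] by blast
    \<comment> \<open>The lift of \<open>u\<close> is \<open>i \<cdot> w\<close>: the arrow
      \<open>w\<close> lifts \<open>Fa h \<cdot> u\<close> through \<open>m\<close>, and the inverse
      \<open>i\<close> then undoes \<open>h\<close>.\<close>
    have "Fa (i \<cdot>\<^bsub>A\<^esub> w) = Fa (i \<cdot>\<^bsub>A\<^esub> h) \<cdot>\<^bsub>C\<^esub> u"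
      using Fa_Comp[OF w(1) i(1)] Fa_Comp[OF hH i(1)] w(2)
        base.Comp_assoc[OF u Fa_Hom[OF hH] Fa_Hom[OF i(1)]] by simp
    also have "\<dots> = u"
      using i(2) Fa_Id[OF dom.HomD(4)[OF hH]] base.Id_Comp[OF u] by simp
    finally have "Fa (i \<cdot>\<^bsub>A\<^esub> w) = u" .
    moreover have "(m \<cdot>\<^bsub>A\<^esub> h) \<cdot>\<^bsub>A\<^esub> (i \<cdot>\<^bsub>A\<^esub> w) = k"
      using dom.Comp_assoc[OF dom.Comp_Hom[OF w(1) i(1)] hH mH]
        dom.Comp_assoc[OF w(1) i(1) hH] i(3) dom.Id_Comp[OF w(1)] w(3) by simp
    ultimately show "\<exists>v\<in>Hom A Z (Dom A h). Fa v = u \<and> (m \<cdot>\<^bsub>A\<^esub> h) \<cdot>\<^bsub>A\<^esub> v = k"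
      using dom.Comp_Hom[OF w(1) i(1)] by blast
  qed
  ultimately show ?thesis using dom.HomD(1)[OF mhH] by (simp add: M_lift_def)
qed

lemma EF_iso:
  assumes e: "e \<in> EF" and h: "is_iso A h" "Dom A h = Cod A e"
  shows "h \<cdot>\<^bsub>A\<^esub> e \<in> EF"
proof -
  have hH: "h \<in> Hom A (Cod A e) (Cod A h)" using h by (simp add: is_iso_def Hom_def)
  have "Fa (h \<cdot>\<^bsub>A\<^esub> e) \<in> E"
    using base.E_iso[OF EF_D(2)[OF e] is_iso_Fa[OF h(1)]] Fa_Comp[OF EF_D(3)[OF e] hH]
      base.HomD[OF EF_D(4)[OF e]] base.HomD[OF Fa_Hom[OF hH]] by simp
  then show ?thesis
    using dom.HomD(1)[OF dom.Comp_Hom[OF EF_D(3)[OF e] hH]] by (simp add: E_lift_def)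
qed

sublocale total: proper_factorization_system A EF MF
proof
  show "\<exists>e\<in>EF. \<exists>m\<in>MF. Cod A e = Dom A m \<and> m \<cdot>\<^bsub>A\<^esub> e = f \<and> Dom A e = Dom A f \<and> Cod A m = Cod A f"
    if "f \<in> Arr A" for f
    by (rule factorization_lift[OF that]) (auto simp: msub_def Hom_def)
  \<comment> \<open>Existence is \<open>diagonal_lift\<close>; uniqueness comes from
    \<open>m\<close> being mono.\<close>
  show "\<exists>!d. d \<in> Hom A (Cod A e) (Dom A m) \<and> d \<cdot>\<^bsub>A\<^esub> e = f \<and> m \<cdot>\<^bsub>A\<^esub> d = g"
    if "e \<in> EF" "m \<in> MF" "f \<in> Hom A (Dom A e) (Dom A m)" "g \<in> Hom A (Cod A e) (Cod A m)"
      "g \<cdot>\<^bsub>A\<^esub> e = m \<cdot>\<^bsub>A\<^esub> f" for e m f g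
    using diagonal_lift[OF that] dom.is_monoD[OF MF_mono[OF that(2)]] by blast
qed (auto intro: EF_epi MF_mono EF_iso MF_iso)

section \<open>Lifting of pullbacks and intersections\<close>

lemma pullback_lift:
  assumes f: "f \<in> Arr A" and n: "n \<in> msub A MF (Cod A f)"
  obtains p q q' where "p \<in> msub A MF (Dom A f)" "is_pullback A f n p q"
    "is_pullback C (Fa f) (Fa n) (Fa p) q'"
proof -
  note fH = dom.HomI[OF f]
  have Fn: "Fa n \<in> msub C M (Cod C (Fa f))" using Fa_msub[OF n] Fa_Cod[OF f] by simp
  obtain p' q' where p': "p' \<in> M" and pb: "is_pullback C (Fa f) (Fa n) p' q'"
    using base.M_pullback[OF Fa_Arr[OF f] Fn] by blast
  have "p' \<in> msub C M (Fo (Dom A f))"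
    using p' pb Fa_Dom[OF f] by (auto simp: msub_def is_pullback_def Hom_def)
  then obtain p where p: "p \<in> msub A MF (Dom A f)" "Fa p = p'"
    using msub_lift dom.HomD(4)[OF fH] by blast
  \<comment> \<open>Both sides are translated to \<open>C\<close>, where they are the criterion for
    the pullback \<open>p'\<close>. The projection \<open>q\<close> then arises inside
    \<open>A\<close>; no relation to \<open>q'\<close> is claimed, since preimages only record the
    first projection.\<close>
  have "factors_through A g p \<longleftrightarrow> factors_through A (f \<cdot>\<^bsub>A\<^esub> g) n" if g: "g \<in> Hom A Z (Dom A f)" for Z g
    using base.pullback_factors_iff[OF pb, of "Fa g" "Fo Z"] Fa_Hom[OF g] Fa_Dom[OF f] p
      factors_through_Fa_iff[OF p(1) g] factors_through_Fa_iff[OF n dom.Comp_Hom[OF g fH]]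
      Fa_Comp[OF g fH] by simp
  then have "\<exists>q. is_pullback A f n p q" using total.pullbackI[OF f n p(1)] by blast
  then show ?thesis using that p pb by blast
qed

text \<open>An intersection in \<open>C\<close> of the arrows \<open>Fa b\<close> is lifted to an
  arrow \<open>m\<close> of \<open>MF\<close>, and factorizations through \<open>m\<close> are
  tested in \<open>C\<close>.\<close>

lemma intersection_lift:
  assumes X: "X \<in> Obj A" and B: "B \<subseteq> msub A MF X"
  shows "\<exists>m\<in>MF. is_intersection A X B m"
proof -
  have FB: "Fa ` B \<subseteq> msub C M (Fo X)" using B Fa_msub by blast
  then obtain m' where m': "m' \<in> M" and int: "is_intersection C (Fo X) (Fa ` B) m'"
    using base.M_intersection[OF Fo_Obj[OF X]] by blast
  then have "m' \<in> msub C M (Fo X)" by (auto simp: msub_def is_intersection_def)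
  then obtain m where m: "m \<in> msub A MF X" "Fa m = m'" using msub_lift[OF X] by blast
  have "factors_through A g m \<longleftrightarrow> (\<forall>b\<in>B. factors_through A g b)" if g: "g \<in> Hom A Z X" for Z g
    using base.intersection_factors_iff[OF int FB Fa_Hom[OF g]] m
      factors_through_Fa_iff[OF m(1) g] factors_through_Fa_iff[OF _ g] B by auto
  then have "is_intersection A X B m" by (rule total.intersectionI[OF m(1)])
  then show ?thesis using m by (auto simp: msub_def)
qed

sublocale total: M_complete_category A EF MF
proof
  show "\<exists>p\<in>MF. \<exists>q. is_pullback A f n p q" if "f \<in> Arr A" "n \<in> msub A MF (Cod A f)" for f n
    by (rule pullback_lift[OF that]) (auto simp: msub_def)
qed (rule intersection_lift)

section \<open>The order isomorphism \<gamma> and its compatibilities\<close>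

lemma \<gamma>_class:
  assumes m: "m \<in> msub A MF X"
  shows "\<gamma> X (total.sub_class X m) = base.sub_class (Fo X) (Fa m)"
proof -
  \<comment> \<open>The union in \<open>sub_map\<close> runs over equivalent representatives; their
    classes coincide, so it collapses to one class.\<close>
  have "base.sub_class (Fo X) (Fa n) = base.sub_class (Fo X) (Fa m)"
    if "n \<in> total.sub_class X m" for n
  proof -
    have n: "n \<in> msub A MF X" "factors_through A m n" "factors_through A n m"
      using that by (auto simp: total.sub_class_eq)
    then show ?thesis
      using base.sub_class_eqI[OF Fa_msub[OF n(1)] Fa_msub[OF m]]
        factors_through_Fa_iff total.msub_Hom m by blast
  qed
  then show ?thesis
    using total.sub_class_self[OF m] unfolding sub_map_def base.sub_class_def[symmetric] by blast
qed

lemma \<gamma>_carrier: "P \<in> carrier (sub A MF X) \<Longrightarrow> \<gamma> X P \<in> carrier (sub C M (Fo X))"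
  by (metis Fa_msub \<gamma>_class base.sub_class_carrier total.sub_carrierE)

lemma \<gamma>_le_iff:
  assumes "P \<in> carrier (sub A MF X)" "Q \<in> carrier (sub A MF X)"
  shows "\<gamma> X P \<sqsubseteq>\<^bsub>sub C M (Fo X)\<^esub> \<gamma> X Q \<longleftrightarrow> P \<sqsubseteq>\<^bsub>sub A MF X\<^esub> Q"
proof -
  obtain m where m: "m \<in> msub A MF X" "P = total.sub_class X m"
    using assms(1) by (rule total.sub_carrierE)
  obtain n where n: "n \<in> msub A MF X" "Q = total.sub_class X n"
    using assms(2) by (rule total.sub_carrierE)
  show ?thesis
    using m n \<gamma>_class base.sub_le_iff[OF Fa_msub[OF m(1)] Fa_msub[OF n(1)]] total.sub_le_iff
      factors_through_Fa_iff[OF n(1) total.msub_Hom[OF m(1)]] by simp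
qed

text \<open>Initial liftings of representatives play the part of the inverse map. Witnesses found in
  \<open>C\<close> are brought back to \<open>A\<close> in this way.\<close>

lemma \<gamma>_surj:
  assumes "X \<in> Obj A" "Q \<in> carrier (sub C M (Fo X))"
  obtains P where "P \<in> carrier (sub A MF X)" "\<gamma> X P = Q"
  by (metis assms \<gamma>_class base.sub_carrierE msub_lift total.sub_class_carrier)

text \<open>\<open>pullback_lift\<close> supplies one arrow \<open>p\<close> that represents the
  preimage in \<open>A\<close> while \<open>Fa p\<close> represents the preimage in
  \<open>C\<close>.\<close>

lemma \<gamma>_preimage:
  assumes f: "f \<in> Arr A" and Q: "Q \<in> carrier (sub A MF (Cod A f))"
  shows "\<gamma> (Dom A f) (sub_preimage A MF f Q) = sub_preimage C M (Fa f) (\<gamma> (Cod A f) Q)"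
proof -
  obtain n where n: "n \<in> msub A MF (Cod A f)" "Q = total.sub_class (Cod A f) n"
    using Q by (rule total.sub_carrierE)
  obtain p q q' where p: "p \<in> msub A MF (Dom A f)" "is_pullback A f n p q"
    "is_pullback C (Fa f) (Fa n) (Fa p) q'"
    using pullback_lift[OF f n(1)] by blast
  show ?thesis
    using total.sub_preimage_class[OF f n(1) p(1,2)] \<gamma>_class[OF n(1)] \<gamma>_class[OF p(1)] n(2)
      base.sub_preimage_class[OF Fa_Arr[OF f] _ _ p(3)] Fa_msub[OF n(1)] Fa_msub[OF p(1)]
      Fa_Dom[OF f] Fa_Cod[OF f] by simp
qed

text \<open>A factorization of \<open>f \<cdot> m\<close> in the lifted system is sent by
  \<open>Fa\<close> to one in \<open>C\<close>, so \<open>n\<close> and \<open>Fa n\<close>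
  represent the two images.\<close>

lemma \<gamma>_image:
  assumes f: "f \<in> Arr A" and P: "P \<in> carrier (sub A MF (Dom A f))"
  shows "sub_image A EF MF f P \<in> carrier (sub A MF (Cod A f))"
    and "\<gamma> (Cod A f) (sub_image A EF MF f P) = sub_image C E M (Fa f) (\<gamma> (Dom A f) P)"
proof -
  note fH = dom.HomI[OF f]
  obtain m where m: "m \<in> msub A MF (Dom A f)" "P = total.sub_class (Dom A f) m"
    using P by (rule total.sub_carrierE)
  note mH = total.msub_Hom[OF m(1)]
  note fm = dom.HomD[OF dom.Comp_Hom[OF mH fH]]
  obtain e n where e: "e \<in> EF" "e \<in> Hom A (Dom A m) (Dom A n)" "n \<cdot>\<^bsub>A\<^esub> e = f \<cdot>\<^bsub>A\<^esub> m"
    and n: "n \<in> msub A MF (Cod A f)"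
    using factorization_lift[OF fm(1)] fm by metis
  note nH = total.msub_Hom[OF n]
  have img: "sub_image A EF MF f P = total.sub_class (Cod A f) n"
    using total.sub_image_class[OF f m(1) n e] m(2) by simp
  show "sub_image A EF MF f P \<in> carrier (sub A MF (Cod A f))"
    using img n total.sub_class_carrier by simp
  have "Fa n \<cdot>\<^bsub>C\<^esub> Fa e = Fa f \<cdot>\<^bsub>C\<^esub> Fa m"
    using Fa_Comp[OF e(2) nH] Fa_Comp[OF mH fH] e(3) by simp
  then have "sub_image C E M (Fa f) (base.sub_class (Fo (Dom A f)) (Fa m)) =
      base.sub_class (Fo (Cod A f)) (Fa n)"
    using base.sub_image_class[OF Fa_Arr[OF f], of "Fa m" "Fa n" "Fa e"] Fa_msub[OF m(1)] Fa_msub[OF n]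
      EF_D(2)[OF e(1)] Fa_Hom[OF e(2)] base.HomD[OF Fa_Hom[OF mH]] base.HomD[OF Fa_Hom[OF nH]]
      Fa_Dom[OF f] Fa_Cod[OF f] by simp
  then show "\<gamma> (Cod A f) (sub_image A EF MF f P) = sub_image C E M (Fa f) (\<gamma> (Dom A f) P)"
    using img \<gamma>_class[OF n] \<gamma>_class[OF m(1)] m(2) by simp
qed

text \<open>An order isomorphism preserves greatest lower bounds; \<open>sub_inf_eqI\<close>
  identifies the transported bound with the meet chosen in \<open>C\<close>.\<close>

lemma \<gamma>_inf:
  assumes X: "X \<in> Obj A" and N: "N \<subseteq> carrier (sub A MF X)"
  shows "\<Sqinter>\<^bsub>sub A MF X\<^esub> N \<in> carrier (sub A MF X)"
    and "\<gamma> X (\<Sqinter>\<^bsub>sub A MF X\<^esub> N) = \<Sqinter>\<^bsub>sub C M (Fo X)\<^esub> (\<gamma> X ` N)"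
proof -
  let ?m = "\<Sqinter>\<^bsub>sub A MF X\<^esub> N"
  have g: "greatest (sub A MF X) ?m (Lower (sub A MF X) N)"
    using total.sub_inf_greatest[OF X N] .
  then show m: "?m \<in> carrier (sub A MF X)" by (auto simp: greatest_def Lower_def)
  have low: "\<gamma> X P \<in> Lower (sub C M (Fo X)) (\<gamma> X ` N) \<longleftrightarrow> P \<in> Lower (sub A MF X) N"
    if "P \<in> carrier (sub A MF X)" for P
    using that N \<gamma>_carrier \<gamma>_le_iff by (auto simp: Lower_def)
  have "greatest (sub C M (Fo X)) (\<gamma> X ?m) (Lower (sub C M (Fo X)) (\<gamma> X ` N))"
    unfolding greatest_def
  proof (intro conjI ballI)
    show "Lower (sub C M (Fo X)) (\<gamma> X ` N) \<subseteq> carrier (sub C M (Fo X))" by (auto simp: Lower_def)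
    show "\<gamma> X ?m \<in> Lower (sub C M (Fo X)) (\<gamma> X ` N)"
      using low[OF m] g by (simp add: greatest_def)
    fix Q assume Q: "Q \<in> Lower (sub C M (Fo X)) (\<gamma> X ` N)"
    \<comment> \<open>A competing lower bound in \<open>C\<close> is pulled back to
      \<open>A\<close>, where the meet of \<open>N\<close> is known to be greatest.\<close>
    then obtain P where P: "P \<in> carrier (sub A MF X)" "\<gamma> X P = Q"
      using \<gamma>_surj[OF X] by (auto simp: Lower_def)
    then show "Q \<sqsubseteq>\<^bsub>sub C M (Fo X)\<^esub> \<gamma> X ?m"
      using Q low[OF P(1)] g \<gamma>_le_iff[OF P(1) m] by (auto simp: greatest_def)
  qed
  then show "\<gamma> X ?m = \<Sqinter>\<^bsub>sub C M (Fo X)\<^esub> (\<gamma> X ` N)"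
    using base.sub_inf_eqI by metis
qed

section \<open>Transport of relations and syntopogenous structures\<close>

lemma sub_relation_lift: "sub_relation A MF X (lift X r)"
  by (auto simp: sub_relation_def lift_relation_def)

lemma T1_lift: "T1 C M (Fo X) r \<Longrightarrow> T1 A MF X (lift X r)"
  unfolding T1_def lift_relation_def using \<gamma>_le_iff by blast

lemma T2_lift:
  assumes "T2 C M (Fo X) r"
  shows "T2 A MF X (lift X r)"
  unfolding T2_def
proof (intro ballI impI)
  fix m n p q
  assume c: "m \<in> carrier (sub A MF X)" "n \<in> carrier (sub A MF X)"
    "p \<in> carrier (sub A MF X)" "q \<in> carrier (sub A MF X)"
    and "m \<sqsubseteq>\<^bsub>sub A MF X\<^esub> n" "(n, p) \<in> lift X r" "p \<sqsubseteq>\<^bsub>sub A MF X\<^esub> q"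
  then have "\<gamma> X m \<sqsubseteq>\<^bsub>sub C M (Fo X)\<^esub> \<gamma> X n" "(\<gamma> X n, \<gamma> X p) \<in> r"
    "\<gamma> X p \<sqsubseteq>\<^bsub>sub C M (Fo X)\<^esub> \<gamma> X q"
    using \<gamma>_le_iff by (auto simp: lift_relation_def)
  then have "(\<gamma> X m, \<gamma> X q) \<in> r"
    using assms[unfolded T2_def, rule_format, OF c[THEN \<gamma>_carrier]] by blast
  then show "(m, q) \<in> lift X r" using c by (simp add: lift_relation_def)
qed

text \<open>The interpolant found in \<open>C\<close> is carried back by surjectivity of \<gamma>;
  \<open>sub_relation\<close> guarantees that it is a subobject.\<close>

lemma interpolates_lift:
  assumes X: "X \<in> Obj A" and "sub_relation C M (Fo X) r" "interpolates r"
  shows "interpolates (lift X r)"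
  unfolding interpolates_def
proof (intro allI impI)
  fix m n assume mn: "(m, n) \<in> lift X r"
  then obtain p where p: "(\<gamma> X m, p) \<in> r" "(p, \<gamma> X n) \<in> r"
    using assms(3) unfolding interpolates_def lift_relation_def by blast
  then obtain q where "q \<in> carrier (sub A MF X)" "\<gamma> X q = p"
    using \<gamma>_surj[OF X] assms(2) unfolding sub_relation_def by blast
  then show "\<exists>q. (m, q) \<in> lift X r \<and> (q, n) \<in> lift X r"
    using mn p by (auto simp: lift_relation_def)
qed

lemma meet_preserving_lift:
  assumes X: "X \<in> Obj A" and "meet_preserving C M (Fo X) r"
  shows "meet_preserving A MF X (lift X r)"
  unfolding meet_preserving_def
proof (intro ballI allI impI)
  fix m N assume m: "m \<in> carrier (sub A MF X)" and N: "N \<subseteq> carrier (sub A MF X)"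
    and "\<forall>n\<in>N. (m, n) \<in> lift X r"
  then have "\<forall>n\<in>\<gamma> X ` N. (\<gamma> X m, n) \<in> r" by (auto simp: lift_relation_def)
  moreover have "\<gamma> X ` N \<subseteq> carrier (sub C M (Fo X))" using N \<gamma>_carrier by blast
  ultimately have "(\<gamma> X m, \<Sqinter>\<^bsub>sub C M (Fo X)\<^esub> (\<gamma> X ` N)) \<in> r"
    using assms(2) \<gamma>_carrier[OF m] unfolding meet_preserving_def by blast
  then show "(m, \<Sqinter>\<^bsub>sub A MF X\<^esub> N) \<in> lift X r"
    using m \<gamma>_inf[OF X N] by (simp add: lift_relation_def)
qed

text \<open>Lifting is an inverse image along \<gamma>, so it commutes with unions. Thus (S3)
  becomes a statement about one lifted relation per object.\<close>

lemma Union_lift_structure: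
  "\<Union>(lift_structure A C M Fo Fa S X) = lift X (\<Union>(S (Fo X)))"
  by (auto simp: lift_structure_def lift_relation_def)

text \<open>For (T3), \<gamma> turns preimages along \<open>f\<close> into preimages along
  \<open>Fa f\<close>, where the property of \<open>T\<close> applies.\<close>

lemma topogenous_order_lift:
  assumes T: "topogenous_order C M T"
  shows "topogenous_order A MF (\<lambda>X. lift X (T (Fo X)))"
  unfolding topogenous_order_def
proof (intro conjI ballI allI impI)
  fix X assume "X \<in> Obj A"
  then have "Fo X \<in> Obj C" by (rule Fo_Obj)
  then show "sub_relation A MF X (lift X (T (Fo X)))" "T1 A MF X (lift X (T (Fo X)))"
    "T2 A MF X (lift X (T (Fo X)))"
    using T sub_relation_lift T1_lift T2_lift by (auto simp: topogenous_order_def)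
next
  fix f m n assume f: "f \<in> Arr A" and mn: "(m, n) \<in> lift (Cod A f) (T (Fo (Cod A f)))"
  then have "(\<gamma> (Cod A f) m, \<gamma> (Cod A f) n) \<in> T (Cod C (Fa f))"
    using Fa_Cod[OF f] by (simp add: lift_relation_def)
  then have "(sub_preimage C M (Fa f) (\<gamma> (Cod A f) m), sub_preimage C M (Fa f) (\<gamma> (Cod A f) n))
      \<in> T (Dom C (Fa f))"
    using T Fa_Arr[OF f] unfolding topogenous_order_def by blast
  then show "(sub_preimage A MF f m, sub_preimage A MF f n) \<in> lift (Dom A f) (T (Fo (Dom A f)))"
    using mn \<gamma>_preimage[OF f] total.sub_preimage_carrier[OF f] Fa_Dom[OF f]
    by (simp add: lift_relation_def)
qed

lemma syntopogenous_structure_lift: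
  assumes S: "syntopogenous_structure C M S"
  shows "syntopogenous_structure A MF (lift_structure A C M Fo Fa S)"
  unfolding syntopogenous_structure_def Union_lift_structure
proof (intro conjI ballI)
  show "topogenous_order A MF (\<lambda>X. lift X (\<Union>(S (Fo X))))"
    using topogenous_order_lift[of "\<lambda>X. \<Union>(S X)"] S by (simp add: syntopogenous_structure_def)
  fix X assume X: "X \<in> Obj A"
  note FX = Fo_Obj[OF X]
  have SX: "\<forall>r\<in>S (Fo X). sub_relation C M (Fo X) r \<and> T1 C M (Fo X) r \<and> T2 C M (Fo X) r"
    "S (Fo X) \<noteq> {}" "\<forall>r\<in>S (Fo X). \<forall>s\<in>S (Fo X). \<exists>t\<in>S (Fo X). r \<subseteq> t \<and> s \<subseteq> t"
    "interpolates (\<Union>(S (Fo X)))"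
    using S FX by (auto simp: syntopogenous_structure_def)
  show "lift_structure A C M Fo Fa S X \<noteq> {}" using SX(2) by (simp add: lift_structure_def)
  have "sub_relation C M (Fo X) (\<Union>(S (Fo X)))" using SX(1) by (auto simp: sub_relation_def)
  then show "interpolates (lift X (\<Union>(S (Fo X))))" using interpolates_lift[OF X] SX(4) by blast
  fix r assume r: "r \<in> lift_structure A C M Fo Fa S X"
  then show "sub_relation A MF X r" "T1 A MF X r" "T2 A MF X r"
    using SX(1) sub_relation_lift T1_lift T2_lift by (auto simp: lift_structure_def)
  fix s assume "s \<in> lift_structure A C M Fo Fa S X"
  then obtain r' s' where rs: "r' \<in> S (Fo X)" "r = lift X r'" "s' \<in> S (Fo X)" "s = lift X s'"
    using r by (auto simp: lift_structure_def)
  \<comment> \<open>Directedness passes upward because lifting is monotone in the relation.\<close>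
  then obtain t where "t \<in> S (Fo X)" "r' \<subseteq> t" "s' \<subseteq> t" using SX(3) by blast
  then have "lift X t \<in> lift_structure A C M Fo Fa S X" "r \<subseteq> lift X t" "s \<subseteq> lift X t"
    using rs by (auto simp: lift_structure_def lift_relation_def)
  then show "\<exists>t\<in>lift_structure A C M Fo Fa S X. r \<subseteq> t \<and> s \<subseteq> t" by blast
qed

text \<open>The syntopogenous assumption places the interpolants in the carrier, as needed to lift
  them.\<close>

lemma interpolative_lift:
  assumes "syntopogenous_structure C M S" "interpolative C S"
  shows "interpolative A (lift_structure A C M Fo Fa S)"
  unfolding interpolative_def
proof (intro ballI)
  fix X r assume X: "X \<in> Obj A" and "r \<in> lift_structure A C M Fo Fa S X"
  then obtain s where s: "s \<in> S (Fo X)" "r = lift X s" by (auto simp: lift_structure_def)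
  then have "sub_relation C M (Fo X) s" "interpolates s"
    using assms Fo_Obj[OF X] by (auto simp: syntopogenous_structure_def interpolative_def)
  then show "interpolates r" using interpolates_lift[OF X] s(2) by blast
qed

lemma co_perfect_lift:
  assumes "co_perfect C M S"
  shows "co_perfect A MF (lift_structure A C M Fo Fa S)"
  using assms Fo_Obj meet_preserving_lift by (auto simp: co_perfect_def lift_structure_def)

text \<open>The relation \<open>s\<close> that answers \<open>r'\<close> for \<open>Fa f\<close> is
  lifted as well. Since \<gamma> commutes with images and preimages, any \<open>q\<close> over the
  witness \<open>p\<close> is a witness in \<open>A\<close>.\<close>

lemma S_initial_lift:
  assumes f: "f \<in> Arr A" and init: "S_initial C E M S (Fa f)"
  shows "S_initial A EF MF (lift_structure A C M Fo Fa S) f"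
  unfolding S_initial_def
proof
  fix r assume "r \<in> lift_structure A C M Fo Fa S (Dom A f)"
  then obtain r' where r': "r' \<in> S (Fo (Dom A f))" "r = lift (Dom A f) r'"
    by (auto simp: lift_structure_def)
  then obtain s where s: "s \<in> S (Fo (Cod A f))"
    and ex: "\<And>m n. (m, n) \<in> r' \<Longrightarrow> \<exists>p\<in>carrier (sub C M (Fo (Cod A f))).
      (sub_image C E M (Fa f) m, p) \<in> s \<and> sub_preimage C M (Fa f) p \<sqsubseteq>\<^bsub>sub C M (Fo (Dom A f))\<^esub> n"
    using init unfolding S_initial_def Fa_Dom[OF f] Fa_Cod[OF f] by blast
  have "\<exists>p\<in>carrier (sub A MF (Cod A f)). (sub_image A EF MF f m, p) \<in> lift (Cod A f) s \<and>
      sub_preimage A MF f p \<sqsubseteq>\<^bsub>sub A MF (Dom A f)\<^esub> n" if "(m, n) \<in> r" for m n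
  proof -
    have mn: "m \<in> carrier (sub A MF (Dom A f))" "n \<in> carrier (sub A MF (Dom A f))"
      "(\<gamma> (Dom A f) m, \<gamma> (Dom A f) n) \<in> r'"
      using that r' by (auto simp: lift_relation_def)
    obtain p where p: "p \<in> carrier (sub C M (Fo (Cod A f)))"
      "(sub_image C E M (Fa f) (\<gamma> (Dom A f) m), p) \<in> s"
      "sub_preimage C M (Fa f) p \<sqsubseteq>\<^bsub>sub C M (Fo (Dom A f))\<^esub> \<gamma> (Dom A f) n"
      using ex[OF mn(3)] by blast
    obtain q where q: "q \<in> carrier (sub A MF (Cod A f))" "\<gamma> (Cod A f) q = p"
      using \<gamma>_surj[OF dom.Cod_Obj[OF f] p(1)] by blast
    \<comment> \<open>After rewriting by \<open>\<gamma>_preimage\<close>, the inequality in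
      \<open>C\<close> compares values of \<gamma>, and \<gamma> reflects the order.\<close>
    have "sub_preimage A MF f q \<sqsubseteq>\<^bsub>sub A MF (Dom A f)\<^esub> n"
      using p(3) q \<gamma>_preimage[OF f q(1)] \<gamma>_le_iff[OF total.sub_preimage_carrier[OF f q(1)] mn(2)] by simp
    moreover have "(sub_image A EF MF f m, q) \<in> lift (Cod A f) s"
      using p(2) q \<gamma>_image[OF f mn(1)] by (simp add: lift_relation_def)
    ultimately show ?thesis using q by blast
  qed
  then show "\<exists>s\<in>lift_structure A C M Fo Fa S (Cod A f). \<forall>m n. (m, n) \<in> r \<longrightarrow>
      (\<exists>p\<in>carrier (sub A MF (Cod A f)). (sub_image A EF MF f m, p) \<in> s \<and>
         sub_preimage A MF f p \<sqsubseteq>\<^bsub>sub A MF (Dom A f)\<^esub> n)"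
    using s by (auto simp: lift_structure_def)
qed

end

theorem proposition11:
  fixes A :: "('o1, 'a1) cat" and C :: "('o2, 'a2) cat"
    and E M :: "'a2 set"
    and Fo :: "'o1 \<Rightarrow> 'o2" and Fa :: "'a1 \<Rightarrow> 'a2"
    and S :: "'o2 \<Rightarrow> 'a2 set rel set"
  assumes "M_complete_category C E M"
    and "faithful_M_fibration A C Fo Fa M"
    and "syntopogenous_structure C M S"
  shows "syntopogenous_structure A (M_lift A C Fo Fa M) (lift_structure A C M Fo Fa S) \<and>
    (interpolative C S \<longrightarrow> interpolative A (lift_structure A C M Fo Fa S)) \<and>
    (co_perfect C M S \<longrightarrow>
       co_perfect A (M_lift A C Fo Fa M) (lift_structure A C M Fo Fa S)) \<and>
    (\<forall>f \<in> Arr A. S_initial C E M S (Fa f) \<longrightarrow>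
       S_initial A (E_lift A Fa E) (M_lift A C Fo Fa M) (lift_structure A C M Fo Fa S) f)"
proof -
  interpret fibration_over_M_complete A C Fo Fa E M
    using assms by (intro fibration_over_M_complete.intro)
  show ?thesis
    using assms(3) syntopogenous_structure_lift interpolative_lift co_perfect_lift S_initial_lift
    by blast
qed

end
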